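(* Let $R$ be a P$v$MD. Then: (1) $R$ is a $t\#$-domain if and only if $R\langle X\rangle$ is a $\#$-domain; (2) $R$ is a $t\#\#$-domain if and only if $R\langle X\rangle$ is a $\#\#$-domain; (3) $R$ is a $tRTP$-domain if and only if $R\langle X\rangle$ is an $RTP$-domain.
   Context: $R$ is an integral domain with quotient field $K\neq R$. For nonzero $R$-submodules $A,B$ of $K$, $(A:B)=\{x\in K: xB\subseteq A\}$. For a nonzero fractional ideal $I$, $I_v=(R:(R:I))$, $I_t=\bigcup\{J_v: J\subseteq I\text{ nonzero finitely generated}\}$; $I$ is a $t$-ideal if $I=I_t$; $t$-primes are prime $t$-ideals; $t\text{-Max}(R)$ is the set of ideals maximal among proper $t$-ideals. $R$ is a P$v$MD if $R_M$ is a valuation domain for every $M\in t\text{-Max}(R)$. For $f\in R[X]$, $c(f)$ is the ideal generated by its coefficients; the $t$-Nagata ring is $R\langle X\rangle=R[X]_{N_t}$ with $N_t=\{f\in R[X]: c(f)_t=R\}$. A domain $D$ is a $\#$-domain if $\bigcap_{M\in\mathcal M_1}D_M\neq\bigcap_{M\in\mathcal M_2}D_M$ for any two distinct nonempty sets $\mathcal M_1,\mathcal M_2$ of maximal ideals, and a $\#\#$-domain if every overring is a $\#$-domain. $R$ is a $t\#$-domain if $\bigcap_{M\in\mathcal M_1}R_M\neq\bigcap_{M\in\mathcal M_2}R_M$ for any two distinct subsets of $t\text{-Max}(R)$, and a $t\#\#$-domain if $\bigcap_{P\in\mathcal P_1}R_P\neq\bigcap_{P\in\mathcal P_2}R_P$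 for any two distinct sets $\mathcal P_1,\mathcal P_2$ of pairwise incomparable $t$-primes. $D$ is an $RTP$-domain if for each nonzero ideal $I$, either $I(D:I)=D$ or $I(D:I)$ is a radical ideal; $R$ is a $tRTP$-domain if for each nonzero ideal $I$, either $(I(R:I))_t=R$ or $(I(R:I))_t$ is a radical ideal. *)

theory Defs
  imports "HOL-Computational_Algebra.Polynomial" "HOL-Computational_Algebra.Fraction_Field"
begin

text \<open>Convention: an integral domain is represented as a subring D of a field type 'a
whose quotient field is the whole of 'a. All modules, ideals, localizations and
overrings are subsets of this ambient field.\<close>

definition is_subring :: "'a::field set \<Rightarrow> bool" where
  "is_subring D \<longleftrightarrow> 0 \<in> D \<and> 1 \<in> D \<and> (\<forall>x\<in>D. \<forall>y\<in>D. x + y \<in> D \<and> x - y \<in> D \<and> x * y \<in> D)"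

definition is_domain_of :: "'a::field set \<Rightarrow> bool" where
  "is_domain_of D \<longleftrightarrow> is_subring D \<and> (\<forall>x. \<exists>a\<in>D. \<exists>b\<in>D. b \<noteq> 0 \<and> x = a / b)"

text \<open>Product of submodules: the set of finite sums of products.
 mod_prod D S is also the D-submodule generated by S.\<close>
definition mod_prod :: "'a::field set \<Rightarrow> 'a set \<Rightarrow> 'a set" where
  "mod_prod A B = {x. \<exists>(n::nat) f g. (\<forall>i<n. f i \<in> A \<and> g i \<in> B) \<and> x = (\<Sum>i<n. f i * g i)}"

definition colon :: "'a::field set \<Rightarrow> 'a set \<Rightarrow> 'a set" where
  "colon A B = {x. \<forall>b\<in>B. x * b \<in> A}"

definition dom_ideal :: "'a::field set \<Rightarrow> 'a set \<Rightarrow> bool" where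
  "dom_ideal D I \<longleftrightarrow> I \<subseteq> D \<and> 0 \<in> I \<and> (\<forall>x\<in>I. \<forall>y\<in>I. x + y \<in> I) \<and> (\<forall>r\<in>D. \<forall>x\<in>I. r * x \<in> I)"

definition dom_prime :: "'a::field set \<Rightarrow> 'a set \<Rightarrow> bool" where
  "dom_prime D P \<longleftrightarrow> dom_ideal D P \<and> P \<noteq> D \<and> (\<forall>a\<in>D. \<forall>b\<in>D. a * b \<in> P \<longrightarrow> a \<in> P \<or> b \<in> P)"

definition dom_maximal :: "'a::field set \<Rightarrow> 'a set \<Rightarrow> bool" where
  "dom_maximal D M \<longleftrightarrow> dom_ideal D M \<and> M \<noteq> D \<and>
     (\<forall>J. dom_ideal D J \<and> M \<subseteq> J \<and> J \<noteq> D \<longrightarrow> J = M)"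

definition radical :: "'a::field set \<Rightarrow> 'a set \<Rightarrow> 'a set" where
  "radical D I = {x \<in> D. \<exists>n::nat. x ^ n \<in> I}"

definition is_radical :: "'a::field set \<Rightarrow> 'a set \<Rightarrow> bool" where
  "is_radical D I \<longleftrightarrow> radical D I = I"

definition loc :: "'a::field set \<Rightarrow> 'a set \<Rightarrow> 'a set" where
  "loc D P = {a / s | a s. a \<in> D \<and> s \<in> D \<and> s \<notin> P}"

definition overring :: "'a::field set \<Rightarrow> 'a set \<Rightarrow> bool" where
  "overring D T \<longleftrightarrow> is_subring T \<and> D \<subseteq> T"

definition valuation_dom :: "'a::field set \<Rightarrow> bool" where
  "valuation_dom V \<longleftrightarrow> (\<forall>x. x \<in> V \<or> inverse x \<in> V)"

definition v_op :: "'a::field set \<Rightarrow> 'a set \<Rightarrow> 'a set" where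
  "v_op R I = colon R (colon R I)"

definition fin_gen_nonzero :: "'a::field set \<Rightarrow> 'a set \<Rightarrow> bool" where
  "fin_gen_nonzero R J \<longleftrightarrow> (\<exists>S. finite S \<and> J = mod_prod R S) \<and> J \<noteq> {0}"

definition t_op :: "'a::field set \<Rightarrow> 'a set \<Rightarrow> 'a set" where
  "t_op R I = \<Union>{v_op R J | J. fin_gen_nonzero R J \<and> J \<subseteq> I}"

definition t_ideal :: "'a::field set \<Rightarrow> 'a set \<Rightarrow> bool" where
  "t_ideal R I \<longleftrightarrow> dom_ideal R I \<and> I \<noteq> {0} \<and> t_op R I = I"

definition t_prime :: "'a::field set \<Rightarrow> 'a set \<Rightarrow> bool" where
  "t_prime R P \<longleftrightarrow> dom_prime R P \<and> t_ideal R P"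

definition t_Max :: "'a::field set \<Rightarrow> 'a set set" where
  "t_Max R = {M. t_ideal R M \<and> M \<noteq> R \<and> (\<forall>J. t_ideal R J \<and> M \<subseteq> J \<and> J \<noteq> R \<longrightarrow> J = M)}"

definition PvMD :: "'a::field set \<Rightarrow> bool" where
  "PvMD R \<longleftrightarrow> (\<forall>M \<in> t_Max R. valuation_dom (loc R M))"

definition sharp_domain :: "'a::field set \<Rightarrow> bool" where
  "sharp_domain D \<longleftrightarrow> (\<forall>M1 M2. M1 \<noteq> {} \<and> M2 \<noteq> {} \<and>
      M1 \<subseteq> {M. dom_maximal D M} \<and> M2 \<subseteq> {M. dom_maximal D M} \<and> M1 \<noteq> M2 \<longrightarrow>
      (\<Inter>M\<in>M1. loc D M) \<noteq> (\<Inter>M\<in>M2. loc D M))"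

definition sharp_sharp_domain :: "'a::field set \<Rightarrow> bool" where
  "sharp_sharp_domain D \<longleftrightarrow> (\<forall>T. overring D T \<longrightarrow> sharp_domain T)"

definition t_sharp :: "'a::field set \<Rightarrow> bool" where
  "t_sharp R \<longleftrightarrow> (\<forall>M1 M2. M1 \<subseteq> t_Max R \<and> M2 \<subseteq> t_Max R \<and> M1 \<noteq> M2 \<longrightarrow>
      (\<Inter>M\<in>M1. loc R M) \<noteq> (\<Inter>M\<in>M2. loc R M))"

definition pairwise_incomparable :: "'a set set \<Rightarrow> bool" where
  "pairwise_incomparable \<P> \<longleftrightarrow> (\<forall>P\<in>\<P>. \<forall>Q\<in>\<P>. P \<subseteq> Q \<longrightarrow> P = Q)"

definition t_sharp_sharp :: "'a::field set \<Rightarrow> bool" where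
  "t_sharp_sharp R \<longleftrightarrow> (\<forall>P1 P2. P1 \<subseteq> {P. t_prime R P} \<and> P2 \<subseteq> {P. t_prime R P} \<and>
      pairwise_incomparable P1 \<and> pairwise_incomparable P2 \<and> P1 \<noteq> P2 \<longrightarrow>
      (\<Inter>P\<in>P1. loc R P) \<noteq> (\<Inter>P\<in>P2. loc R P))"

definition RTP_domain :: "'a::field set \<Rightarrow> bool" where
  "RTP_domain D \<longleftrightarrow> (\<forall>I. dom_ideal D I \<and> I \<noteq> {0} \<longrightarrow>
      mod_prod I (colon D I) = D \<or> is_radical D (mod_prod I (colon D I)))"

definition tRTP_domain :: "'a::field set \<Rightarrow> bool" where
  "tRTP_domain R \<longleftrightarrow> (\<forall>I. dom_ideal R I \<and> I \<noteq> {0} \<longrightarrow>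
      t_op R (mod_prod I (colon R I)) = R \<or> is_radical R (t_op R (mod_prod I (colon R I))))"

definition poly_ring :: "'a::field set \<Rightarrow> 'a poly set" where
  "poly_ring R = {f. \<forall>i. coeff f i \<in> R}"

definition content_ideal :: "'a::field set \<Rightarrow> 'a poly \<Rightarrow> 'a set" where
  "content_ideal R f = mod_prod R (range (coeff f))"

definition N_t :: "'a::field set \<Rightarrow> 'a poly set" where
  "N_t R = {f \<in> poly_ring R. t_op R (content_ideal R f) = R}"

definition t_Nagata :: "'a::field set \<Rightarrow> 'a poly fract set" where
  "t_Nagata R = {Fract f g | f g. f \<in> poly_ring R \<and> g \<in> N_t R}"

end

theory Submission
  imports Defs "HOL-Computational_Algebra.Polynomial_Factorial"
begin

text \<open>
  Let \<open>D\<close> be the t-Nagata ring. In a PvMD every finitely generated ideal is t-invertible, so by Gauss'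
  lemma at the valuation rings \<open>R\<^sub>M\<close> each nonzero \<open>f\<close> over the quotient field \<open>K\<close> has a cofactor \<open>h\<close> with
  \<open>c(f) c(h) \<subseteq> R\<close> and \<open>f h \<in> N\<^sub>t\<close>; hence \<open>f D = c(f) D\<close>. It follows that \<open>N \<mapsto> N \<inter> K\<close> is an order isomorphism
  from the nonzero \<open>D\<close>-submodules of \<open>K(X)\<close> onto the nonzero t-closed \<open>R\<close>-submodules of \<open>K\<close>, compatible (up to
  t-closure) with products, colons, primes, radicals, maximal ideals and localizations. This gives (3), and it
  transports the injectivity of \<open>\<P> \<mapsto> \<Inter>\<^bsub>P \<in> \<P>\<^esub> D\<^sub>P\<close> on sets of primes, which gives (1) and reduces (2) to a statement
  about \<open>D\<close> alone: \<open>D\<close> is Bezout, and a Bezout domain is a \<open>##\<close>-domain if and only if that map is injective on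
  sets of pairwise incomparable nonzero primes.

  Each localization of an overring \<open>T\<close> at a maximal ideal is the localization of \<open>D\<close> at the contracted prime, which
  yields one direction of this criterion. Conversely, let \<open>T\<close> be the common intersection of the localizations at two
  families of pairwise incomparable primes. As \<open>T\<close> is a \<open>#\<close>-domain, each maximal ideal \<open>N\<close> of \<open>T\<close> has an element \<open>a\<close>
  lying in no other maximal ideal; \<open>a\<close> lies in a member of either family, necessarily below \<open>N\<close>, and a gcd argument
  shows that these two members coincide.
\<close>

section \<open>Submodules of a field\<close>

definition submod :: "'a::field set \<Rightarrow> 'a set \<Rightarrow> bool" where
  "submod D A \<longleftrightarrow> 0 \<in> A \<and> (\<forall>x\<in>A. \<forall>y\<in>A. x + y \<in> A) \<and> (\<forall>r\<in>D. \<forall>x\<in>A. r * x \<in> A)"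

lemma submod_zero: "submod D A \<Longrightarrow> 0 \<in> A"
  by (simp add: submod_def)

lemma submod_add: "submod D A \<Longrightarrow> x \<in> A \<Longrightarrow> y \<in> A \<Longrightarrow> x + y \<in> A"
  by (simp add: submod_def)

lemma submod_mult: "submod D A \<Longrightarrow> r \<in> D \<Longrightarrow> x \<in> A \<Longrightarrow> r * x \<in> A"
  by (simp add: submod_def)

lemma submod_mult_right: "submod D A \<Longrightarrow> x \<in> A \<Longrightarrow> r \<in> D \<Longrightarrow> x * r \<in> A"
  by (metis submod_mult mult.commute)

lemma submod_sum:
  assumes "submod D A" "\<And>i. i \<in> I \<Longrightarrow> f i \<in> A"
  shows "sum f I \<in> A"
  using assms(2)
  by (induction I rule: infinite_finite_induct) (auto intro: submod_zero[OF assms(1)] submod_add[OF assms(1)])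

lemma submod_nonzeroE:
  assumes "submod D A" "A \<noteq> {0}"
  obtains a where "a \<in> A" "a \<noteq> 0"
  using assms submod_zero by blast

lemma submod_singleton_zero: "submod D {0}"
  by (simp add: submod_def)

lemma submod_Int: "submod D A \<Longrightarrow> submod D B \<Longrightarrow> submod D (A \<inter> B)"
  by (auto simp: submod_def)

lemma submod_restrict_scalars: "submod T A \<Longrightarrow> D \<subseteq> T \<Longrightarrow> submod D A"
  by (auto simp: submod_def)

lemma submod_vimage_mult: "submod D A \<Longrightarrow> submod D {x. y * x \<in> A}"
  by (auto simp: submod_def ring_distribs mult.left_commute)

lemma submod_Union_chain:
  assumes chain: "subset.chain \<A> \<C>" and "\<C> \<noteq> {}" and submod: "\<And>A. A \<in> \<C> \<Longrightarrow> submod D A"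
  shows "submod D (\<Union>\<C>)"
proof -
  have "x + y \<in> \<Union>\<C>" if xy: "x \<in> \<Union>\<C>" "y \<in> \<Union>\<C>" for x y
  proof -
    have "finite {x, y}" "{x, y} \<subseteq> \<Union>\<C>"
      using xy by simp_all
    then obtain A where "A \<in> \<C>" "{x, y} \<subseteq> A"
      using \<open>\<C> \<noteq> {}\<close> chain by (rule finite_subset_Union_chain)
    then have "x + y \<in> A"
      by (intro submod_add[OF submod[OF \<open>A \<in> \<C>\<close>]]) simp_all
    then show ?thesis
      using \<open>A \<in> \<C>\<close> by blast
  qed
  moreover have "0 \<in> \<Union>\<C>"
    using \<open>\<C> \<noteq> {}\<close> submod submod_zero by blast
  moreover have "r * x \<in> \<Union>\<C>" if "r \<in> D" "x \<in> \<Union>\<C>" for r x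
    using that submod submod_mult by blast
  ultimately show ?thesis
    by (simp add: submod_def)
qed

lemma subring_zero: "is_subring D \<Longrightarrow> 0 \<in> D"
  by (simp add: is_subring_def)

lemma subring_one: "is_subring D \<Longrightarrow> 1 \<in> D"
  by (simp add: is_subring_def)

lemma subring_add: "is_subring D \<Longrightarrow> x \<in> D \<Longrightarrow> y \<in> D \<Longrightarrow> x + y \<in> D"
  by (simp add: is_subring_def)

lemma subring_diff: "is_subring D \<Longrightarrow> x \<in> D \<Longrightarrow> y \<in> D \<Longrightarrow> x - y \<in> D"
  by (simp add: is_subring_def)

lemma subring_mult: "is_subring D \<Longrightarrow> x \<in> D \<Longrightarrow> y \<in> D \<Longrightarrow> x * y \<in> D"
  by (simp add: is_subring_def)

lemma subring_uminus: "is_subring D \<Longrightarrow> x \<in> D \<Longrightarrow> - x \<in> D"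
  using subring_diff[of D 0 x] by (simp add: subring_zero)

lemma submod_self: "is_subring D \<Longrightarrow> submod D D"
  by (simp add: submod_def is_subring_def)

lemma submod_diff:
  assumes "is_subring D" "submod D A" "x \<in> A" "y \<in> A"
  shows "x - y \<in> A"
proof -
  have "- 1 * y \<in> A"
    using assms by (intro submod_mult[of D] subring_uminus subring_one)
  then have "x + - 1 * y \<in> A"
    using assms by (intro submod_add[of D])
  then show ?thesis
    by simp
qed

lemma is_subring_iff_submod: "is_subring D \<longleftrightarrow> submod D D \<and> 1 \<in> D \<and> - 1 \<in> D"
proof
  assume D: "submod D D \<and> 1 \<in> D \<and> - 1 \<in> D"
  have "x + - 1 * y \<in> D" if "x \<in> D" "y \<in> D" for x y
    using D that by (intro submod_add[of D] submod_mult[of D D]) auto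
  then show "is_subring D"
    using D by (simp add: is_subring_def submod_def)
qed (simp add: submod_self subring_one subring_uminus)

lemma overring_subring: "overring D T \<Longrightarrow> is_subring T"
  by (simp add: overring_def)

lemma overring_superset: "overring D T \<Longrightarrow> D \<subseteq> T"
  by (simp add: overring_def)

lemma mod_prodI: "a \<in> A \<Longrightarrow> b \<in> B \<Longrightarrow> a * b \<in> mod_prod A B"
  unfolding mod_prod_def by (intro CollectI exI[of _ "1::nat"] exI[of _ "\<lambda>_. a"] exI[of _ "\<lambda>_. b"]) auto

lemma mod_prodE:
  assumes "x \<in> mod_prod A B"
  obtains n :: nat and f g where "\<forall>i<n. f i \<in> A" "\<forall>i<n. g i \<in> B" "x = (\<Sum>i<n. f i * g i)"
  using assms unfolding mod_prod_def by blast

lemma mod_prod_sumI: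
  "\<forall>i<n. f i \<in> A \<Longrightarrow> \<forall>i<n. g i \<in> B \<Longrightarrow> (\<Sum>i<n. f i * g i) \<in> mod_prod A B"
  for n :: nat
  unfolding mod_prod_def by blast

lemma mod_prod_add:
  assumes "x \<in> mod_prod A B" "y \<in> mod_prod A B"
  shows "x + y \<in> mod_prod A B"
proof -
  obtain n :: nat and f g where x: "\<forall>i<n. f i \<in> A" "\<forall>i<n. g i \<in> B" "x = (\<Sum>i<n. f i * g i)"
    using assms(1) by (rule mod_prodE)
  obtain m :: nat and f' g' where y: "\<forall>i<m. f' i \<in> A" "\<forall>i<m. g' i \<in> B" "y = (\<Sum>i<m. f' i * g' i)"
    using assms(2) by (rule mod_prodE)
  define F where "F = (\<lambda>i. if i < n then f i else f' (i - n))"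
  define G where "G = (\<lambda>i. if i < n then g i else g' (i - n))"
  have "(\<Sum>i<n+m. F i * G i) = (\<Sum>i<n. F i * G i) + (\<Sum>i<m. F (n + i) * G (n + i))"
    by (induction m) auto
  also have "\<dots> = x + y"
    by (simp add: F_def G_def x(3) y(3))
  finally show ?thesis
    using mod_prod_sumI[of "n + m" F A G B] x(1,2) y(1,2) by (simp add: F_def G_def)
qed

lemma mod_prod_least:
  assumes "submod D C" "\<And>a b. a \<in> A \<Longrightarrow> b \<in> B \<Longrightarrow> a * b \<in> C"
  shows "mod_prod A B \<subseteq> C"
  unfolding mod_prod_def by (auto intro!: submod_sum[OF assms(1)] assms(2))

lemma mod_prod_mono: "A \<subseteq> A' \<Longrightarrow> B \<subseteq> B' \<Longrightarrow> mod_prod A B \<subseteq> mod_prod A' B'"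
  unfolding mod_prod_def by (intro Collect_mono impI, elim exE conjE, intro exI conjI) auto

lemma mod_prod_commute: "mod_prod A B = mod_prod B A"
proof -
  have "mod_prod A B \<subseteq> mod_prod B A" for A B :: "'a set"
  proof
    fix x assume "x \<in> mod_prod A B"
    then obtain n :: nat and f g
      where "\<forall>i<n. f i \<in> A" "\<forall>i<n. g i \<in> B" "x = (\<Sum>i<n. f i * g i)"
      by (rule mod_prodE)
    then show "x \<in> mod_prod B A"
      using mod_prod_sumI[of n g B f A] by (simp add: mult.commute)
  qed
  then show ?thesis
    by blast
qed

lemma submod_mod_prod:
  assumes "submod D A"
  shows "submod D (mod_prod A B)"
proof -
  have "r * x \<in> mod_prod A B" if "r \<in> D" "x \<in> mod_prod A B" for r x
    using that(2)
  proof (rule mod_prodE)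
    fix n f g assume "\<forall>i<n. f i \<in> A" "\<forall>i<n. g i \<in> B" "x = (\<Sum>i<(n::nat). f i * g i)"
    then show ?thesis
      using mod_prod_sumI[of n "\<lambda>i. r * f i" A g B] submod_mult[OF assms \<open>r \<in> D\<close>]
      by (simp add: sum_distrib_left mult.assoc)
  qed
  moreover have "0 \<in> mod_prod A B"
    using mod_prod_sumI[of 0] by simp
  ultimately show ?thesis
    by (simp add: submod_def mod_prod_add)
qed

lemma finite_subset_mod_prodE:
  assumes "finite F" "F \<subseteq> mod_prod A B"
  obtains S where "finite S" "S \<subseteq> B" "F \<subseteq> mod_prod A S"
proof -
  have "\<exists>S. finite S \<and> S \<subseteq> B \<and> F \<subseteq> mod_prod A S"
    using assms
  proof (induction F rule: finite_induct)
    case empty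
    show ?case
      by (intro exI[of _ "{}"]) simp
  next
    case (insert x F)
    then obtain S where S: "finite S" "S \<subseteq> B" "F \<subseteq> mod_prod A S"
      by auto
    have "x \<in> mod_prod A B"
      using insert.prems by simp
    then obtain n :: nat and f g
      where x: "\<forall>i<n. f i \<in> A" "\<forall>i<n. g i \<in> B" "x = (\<Sum>i<n. f i * g i)"
      by (rule mod_prodE)
    have "x \<in> mod_prod A (S \<union> g ` {..<n})"
      unfolding x(3) using x(1) by (intro mod_prod_sumI) auto
    then show ?case
      using S x(2) mod_prod_mono[of A A S "S \<union> g ` {..<n}"]
      by (intro exI[of _ "S \<union> g ` {..<n}"]) auto
  qed
  then show ?thesis
    using that by blast
qed

lemma submod_colon: "is_subring D \<Longrightarrow> submod D (colon D A)"
  by (auto simp: submod_def colon_def ring_distribs subring_zero subring_add subring_mult mult.assoc)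

lemma colon_antimono: "A \<subseteq> B \<Longrightarrow> colon D B \<subseteq> colon D A"
  by (auto simp: colon_def)

lemma colon_insert_zero: "is_subring D \<Longrightarrow> colon D (insert 0 S) = colon D S"
  by (simp add: colon_def subring_zero)

context
  fixes D :: "'a::field set"
  assumes D: "is_subring D"
begin

lemma submod_generated: "submod D (mod_prod D S)"
  by (intro submod_mod_prod submod_self D)

lemma generated_superset: "S \<subseteq> mod_prod D S"
proof
  fix x assume "x \<in> S"
  then have "1 * x \<in> mod_prod D S"
    by (intro mod_prodI subring_one D)
  then show "x \<in> mod_prod D S"
    by simp
qed

lemma generated_subset_iff:
  assumes "submod D A"
  shows "mod_prod D S \<subseteq> A \<longleftrightarrow> S \<subseteq> A"
proof
  show "S \<subseteq> A" if "mod_prod D S \<subseteq> A"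
    using that generated_superset by blast
  show "mod_prod D S \<subseteq> A" if "S \<subseteq> A"
    using that by (intro mod_prod_least[OF assms] submod_mult[OF assms]) auto
qed

lemma generated_eqI: "S \<subseteq> mod_prod D T \<Longrightarrow> T \<subseteq> mod_prod D S \<Longrightarrow> mod_prod D S = mod_prod D T"
  by (simp add: generated_subset_iff submod_generated subset_antisym)

lemma generated_insert_zero: "mod_prod D (insert 0 S) = mod_prod D S"
  using generated_superset[of S] generated_superset[of "insert 0 S"]
  by (intro generated_eqI) (auto intro: submod_zero submod_generated)

lemma generated_eq_zero_iff: "mod_prod D S = {0} \<longleftrightarrow> S \<subseteq> {0}"
  using generated_subset_iff[OF submod_singleton_zero] submod_zero[OF submod_generated] by blast

lemma generated_singleton: "mod_prod D {z} = {d * z | d. d \<in> D}"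
proof
  have "submod D {d * z | d. d \<in> D}"
    unfolding submod_def
  proof (intro conjI ballI)
    show "0 \<in> {d * z | d. d \<in> D}"
      using subring_zero[OF D] by force
    show "x + y \<in> {d * z | d. d \<in> D}" if "x \<in> {d * z | d. d \<in> D}" "y \<in> {d * z | d. d \<in> D}" for x y
      using that subring_add[OF D] by (auto simp flip: distrib_right)
    show "r * x \<in> {d * z | d. d \<in> D}" if "r \<in> D" "x \<in> {d * z | d. d \<in> D}" for r x
      using that subring_mult[OF D] by (auto simp flip: mult.assoc)
  qed
  then show "mod_prod D {z} \<subseteq> {d * z | d. d \<in> D}"
    by (rule mod_prod_least) auto
qed (auto intro: mod_prodI)

lemma generated_pair: "mod_prod D {x, y} = {c * x + d * y | c d. c \<in> D \<and> d \<in> D}"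
proof
  let ?L = "{c * x + d * y | c d. c \<in> D \<and> d \<in> D}"
  have "submod D ?L"
    unfolding submod_def
  proof (intro conjI ballI)
    show "0 \<in> ?L"
      using subring_zero[OF D] by force
    show "u + v \<in> ?L" if uv: "u \<in> ?L" "v \<in> ?L" for u v
    proof -
      obtain c d where "u = c * x + d * y" "c \<in> D" "d \<in> D"
        using uv by blast
      moreover obtain c' d' where "v = c' * x + d' * y" "c' \<in> D" "d' \<in> D"
        using uv by blast
      ultimately show ?thesis
        by (intro CollectI exI[of _ "c + c'"] exI[of _ "d + d'"]) (simp add: algebra_simps subring_add[OF D])
    qed
    show "r * u \<in> ?L" if "r \<in> D" and u: "u \<in> ?L" for r u
    proof -
      obtain c d where "u = c * x + d * y" "c \<in> D" "d \<in> D"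
        using u by blast
      then show ?thesis
        using \<open>r \<in> D\<close>
        by (intro CollectI exI[of _ "r * c"] exI[of _ "r * d"]) (simp add: algebra_simps subring_mult[OF D])
    qed
  qed
  moreover have "x \<in> ?L" "y \<in> ?L"
    using subring_zero[OF D] subring_one[OF D] by force+
  ultimately show "mod_prod D {x, y} \<subseteq> ?L"
    by (simp add: generated_subset_iff)
  show "?L \<subseteq> mod_prod D {x, y}"
    using submod_generated generated_superset[of "{x, y}"] by (auto intro!: submod_add submod_mult)
qed

lemma mod_prod_generated:
  "mod_prod (mod_prod D A) (mod_prod D B) = mod_prod D {a * b | a b. a \<in> A \<and> b \<in> B}"
    (is "_ = mod_prod D ?AB")
proof
  have mult_generated: "z * y \<in> mod_prod D ?AB"
    if "y \<in> mod_prod D B" "\<And>b. b \<in> B \<Longrightarrow> z * b \<in> mod_prod D ?AB" for y z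
    using generated_subset_iff[OF submod_vimage_mult[OF submod_generated[of ?AB], of z], of B] that by blast
  show "mod_prod (mod_prod D A) (mod_prod D B) \<subseteq> mod_prod D ?AB"
  proof (rule mod_prod_least[OF submod_generated mult_generated])
    fix x b assume x: "x \<in> mod_prod D A" and "b \<in> B"
    then have "A \<subseteq> {u. b * u \<in> mod_prod D ?AB}"
      using generated_superset[of ?AB] by (force simp: mult.commute)
    then have "mod_prod D A \<subseteq> {u. b * u \<in> mod_prod D ?AB}"
      by (simp add: generated_subset_iff submod_vimage_mult submod_generated)
    then show "x * b \<in> mod_prod D ?AB"
      using x by (auto simp: mult.commute)
  qed
  have "?AB \<subseteq> mod_prod (mod_prod D A) (mod_prod D B)"
    using generated_superset[of A] generated_superset[of B] by (auto intro: mod_prodI)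
  then show "mod_prod D ?AB \<subseteq> mod_prod (mod_prod D A) (mod_prod D B)"
    by (simp add: generated_subset_iff submod_mod_prod submod_generated)
qed

lemma colon_generated: "colon D (mod_prod D S) = colon D S"
proof
  show "colon D (mod_prod D S) \<subseteq> colon D S"
    by (intro colon_antimono generated_superset)
  show "colon D S \<subseteq> colon D (mod_prod D S)"
  proof
    fix x assume "x \<in> colon D S"
    then have "mod_prod D S \<subseteq> {y. x * y \<in> D}"
      by (subst generated_subset_iff) (auto simp: colon_def submod_vimage_mult submod_self D)
    then show "x \<in> colon D (mod_prod D S)"
      by (auto simp: colon_def)
  qed
qed

end

section \<open>Ideals\<close>

lemma dom_ideal_iff_submod: "dom_ideal D I \<longleftrightarrow> submod D I \<and> I \<subseteq> D"
  by (auto simp: dom_ideal_def submod_def)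

lemma dom_ideal_submod: "dom_ideal D I \<Longrightarrow> submod D I"
  by (simp add: dom_ideal_iff_submod)

lemma dom_ideal_subset: "dom_ideal D I \<Longrightarrow> I \<subseteq> D"
  by (simp add: dom_ideal_iff_submod)

lemma dom_ideal_ne_iff:
  assumes "dom_ideal D I" "1 \<in> D"
  shows "I \<noteq> D \<longleftrightarrow> 1 \<notin> I"
  using assms unfolding dom_ideal_def by (metis mult.right_neutral subsetI subset_antisym)

lemma dom_ideal_generated: "is_subring D \<Longrightarrow> S \<subseteq> D \<Longrightarrow> dom_ideal D (mod_prod D S)"
  by (simp add: dom_ideal_iff_submod submod_generated generated_subset_iff submod_self)

lemma dom_ideal_residual:
  assumes "is_subring D" "dom_ideal D I"
  shows "dom_ideal D {x \<in> D. b * x \<in> I}"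
proof -
  have "{x \<in> D. b * x \<in> I} = {x. b * x \<in> I} \<inter> D"
    by blast
  then show ?thesis
    using assms by (simp add: dom_ideal_iff_submod submod_Int submod_vimage_mult submod_self)
qed

lemma dom_prime_ideal: "dom_prime D P \<Longrightarrow> dom_ideal D P"
  by (simp add: dom_prime_def)

lemma dom_prime_submod: "dom_prime D P \<Longrightarrow> submod D P"
  by (intro dom_ideal_submod dom_prime_ideal)

lemma dom_prime_subset: "dom_prime D P \<Longrightarrow> P \<subseteq> D"
  by (intro dom_ideal_subset dom_prime_ideal)

lemma dom_prime_multD: "dom_prime D P \<Longrightarrow> a * b \<in> P \<Longrightarrow> a \<in> D \<Longrightarrow> b \<in> D \<Longrightarrow> a \<in> P \<or> b \<in> P"
  by (simp add: dom_prime_def)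

lemma dom_prime_one_notin:
  assumes "dom_prime D P"
  shows "1 \<notin> P"
proof
  assume "1 \<in> P"
  then have "D \<subseteq> P"
    using submod_mult[OF dom_prime_submod[OF assms], of _ 1] by auto
  then show False
    using assms by (auto simp: dom_prime_def dom_ideal_def)
qed

lemma dom_primeI:
  assumes "dom_ideal D P" "1 \<in> D" "1 \<notin> P" "\<And>a b. a \<in> D \<Longrightarrow> b \<in> D \<Longrightarrow> a * b \<in> P \<Longrightarrow> a \<in> P \<or> b \<in> P"
  shows "dom_prime D P"
  using assms by (auto simp: dom_prime_def)

lemma dom_prime_contraction:
  assumes "dom_prime T P" "is_subring D" "D \<subseteq> T"
  shows "dom_prime D (P \<inter> D)"
proof (rule dom_primeI)
  show "dom_ideal D (P \<inter> D)"
    using submod_restrict_scalars[OF dom_prime_submod[OF assms(1)] assms(3)] assms(2)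
    by (simp add: dom_ideal_iff_submod submod_Int submod_self)
  show "1 \<in> D" "1 \<notin> P \<inter> D"
    using assms(2) dom_prime_one_notin[OF assms(1)] by (simp_all add: subring_one)
  show "a \<in> P \<inter> D \<or> b \<in> P \<inter> D" if "a \<in> D" "b \<in> D" "a * b \<in> P \<inter> D" for a b
    using that dom_prime_multD[OF assms(1), of a b] assms(3) by blast
qed

definition maximal_proper :: "('a::field set \<Rightarrow> bool) \<Rightarrow> 'a set \<Rightarrow> 'a set \<Rightarrow> bool" where
  "maximal_proper Q D M \<longleftrightarrow> Q M \<and> M \<noteq> D \<and> (\<forall>J. Q J \<and> M \<subseteq> J \<and> J \<noteq> D \<longrightarrow> J = M)"

lemma dom_maximal_iff: "dom_maximal D M \<longleftrightarrow> maximal_proper (dom_ideal D) D M"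
  by (simp add: dom_maximal_def maximal_proper_def)

lemma maximal_proper_exists:
  assumes ideal: "\<And>J. Q J \<Longrightarrow> dom_ideal D J" and one: "1 \<in> D"
    and chain: "\<And>\<C>. \<C> \<noteq> {} \<Longrightarrow> subset.chain (Collect Q) \<C> \<Longrightarrow> Q (\<Union>\<C>)"
    and I: "Q I" "I \<noteq> D"
  obtains M where "maximal_proper Q D M" "I \<subseteq> M"
proof -
  have proper: "J \<noteq> D \<longleftrightarrow> 1 \<notin> J" if "Q J" for J
    using dom_ideal_ne_iff[OF ideal[OF that] one] .
  let ?\<A> = "{J. Q J \<and> 1 \<notin> J \<and> I \<subseteq> J}"
  have "\<exists>M\<in>?\<A>. \<forall>J\<in>?\<A>. M \<subseteq> J \<longrightarrow> J = M"
  proof (rule subset_Zorn_nonempty)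
    show "?\<A> \<noteq> {}"
      using I proper by blast
    fix \<C> assume "\<C> \<noteq> {}" and \<C>: "subset.chain ?\<A> \<C>"
    then have "subset.chain (Collect Q) \<C>"
      by (auto simp: subset_chain_def)
    then show "\<Union>\<C> \<in> ?\<A>"
      using chain[OF \<open>\<C> \<noteq> {}\<close>] \<open>\<C> \<noteq> {}\<close> \<C> by (auto simp: subset_chain_def)
  qed
  then obtain M where "M \<in> ?\<A>" "\<forall>J\<in>?\<A>. M \<subseteq> J \<longrightarrow> J = M"
    by (rule bexE)
  then have "maximal_proper Q D M" "I \<subseteq> M"
    using proper by (auto simp: maximal_proper_def)
  then show ?thesis
    by (rule that)
qed

text \<open>For \<open>b \<notin> M\<close> the residual \<open>(M : b)\<close> is a proper member of \<open>Q\<close> containing \<open>M\<close>, hence equals \<open>M\<close>.\<close>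

lemma maximal_proper_prime:
  assumes D: "is_subring D" and M: "maximal_proper Q D M" and ideal: "\<And>J. Q J \<Longrightarrow> dom_ideal D J"
    and residual: "\<And>b. b \<in> D \<Longrightarrow> b \<notin> M \<Longrightarrow> Q {x \<in> D. b * x \<in> M}"
  shows "dom_prime D M"
proof -
  have QM: "Q M" "M \<noteq> D"
    using M by (simp_all add: maximal_proper_def)
  note M_ideal = ideal[OF QM(1)]
  have "a \<in> M" if "a \<in> D" "b \<in> D" "a * b \<in> M" "b \<notin> M" for a b
  proof -
    let ?J = "{x \<in> D. b * x \<in> M}"
    have "?J \<noteq> D"
      using \<open>b \<notin> M\<close> subring_one[OF D] by force
    moreover have "M \<subseteq> ?J"
      using M_ideal \<open>b \<in> D\<close> submod_mult[OF dom_ideal_submod[OF M_ideal]] by (auto dest: dom_ideal_subset)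
    ultimately have "?J = M"
      using M residual[OF that(2,4)] by (simp add: maximal_proper_def)
    moreover have "a \<in> ?J"
      using that by (simp add: mult.commute)
    ultimately show ?thesis
      by blast
  qed
  then show ?thesis
    using QM(2) M_ideal by (auto simp: dom_prime_def)
qed

lemma dom_maximal_prime:
  assumes "is_subring D" "dom_maximal D M"
  shows "dom_prime D M"
proof (rule maximal_proper_prime)
  show "maximal_proper (dom_ideal D) D M"
    using assms(2) by (simp add: dom_maximal_iff)
  show "dom_ideal D {x \<in> D. b * x \<in> M}" for b
    using assms by (intro dom_ideal_residual) (simp_all add: dom_maximal_def)
qed (fact assms(1))+

lemma proper_ideal_in_maximal:
  assumes D: "is_subring D" and I: "dom_ideal D I" "I \<noteq> D"
  obtains M where "dom_maximal D M" "I \<subseteq> M"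
proof -
  have "dom_ideal D (\<Union>\<C>)" if "\<C> \<noteq> {}" "subset.chain (Collect (dom_ideal D)) \<C>" for \<C>
  proof -
    have "dom_ideal D J" if "J \<in> \<C>" for J
      using \<open>subset.chain (Collect (dom_ideal D)) \<C>\<close> that by (auto simp: subset_chain_def)
    then show ?thesis
      using submod_Union_chain[OF that(2,1) dom_ideal_submod] by (auto simp: dom_ideal_iff_submod)
  qed
  then show ?thesis
    using maximal_proper_exists[of "dom_ideal D" D I] that subring_one[OF D] I by (auto simp: dom_maximal_iff)
qed

lemma prime_in_maximal:
  assumes "is_subring D" "dom_prime D P"
  obtains M where "dom_maximal D M" "P \<subseteq> M"
  using proper_ideal_in_maximal[OF assms(1), of P] assms(2) by (auto simp: dom_prime_def)

lemma maximal_zero_imp_inverse_closed: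
  assumes D: "is_subring D" and zero: "dom_maximal D {0}" and x: "x \<in> D" "x \<noteq> 0"
  shows "inverse x \<in> D"
proof -
  have "mod_prod D {x} \<noteq> {0}"
    using generated_superset[OF D, of "{x}"] x(2) by auto
  then have "mod_prod D {x} = D"
    using zero dom_ideal_generated[OF D, of "{x}"] x(1) submod_zero[OF submod_generated[OF D]]
    by (auto simp: dom_maximal_def)
  then obtain d where "d \<in> D" "1 = d * x"
    using subring_one[OF D] generated_singleton[OF D] by blast
  then show ?thesis
    by (metis inverse_unique mult.commute)
qed

lemma is_radical_iff:
  assumes "I \<subseteq> D"
  shows "is_radical D I \<longleftrightarrow> (\<forall>x\<in>D. \<forall>n. x ^ n \<in> I \<longrightarrow> x \<in> I)"
proof -
  have "I \<subseteq> radical D I"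
    using assms by (auto simp: radical_def intro: exI[of _ "1::nat"])
  then show ?thesis
    by (auto simp: is_radical_def radical_def)
qed

definition trace_ideal :: "'a::field set \<Rightarrow> 'a set \<Rightarrow> 'a set" where
  "trace_ideal D I = mod_prod I (colon D I)"

lemma trace_ideal_subset: "is_subring D \<Longrightarrow> trace_ideal D I \<subseteq> D"
  unfolding trace_ideal_def by (intro mod_prod_least[OF submod_self]) (auto simp: colon_def mult.commute)

lemma submod_trace_ideal: "submod D I \<Longrightarrow> submod D (trace_ideal D I)"
  by (simp add: trace_ideal_def submod_mod_prod)

lemma ideal_subset_trace_ideal:
  assumes "dom_ideal D I"
  shows "I \<subseteq> trace_ideal D I"
proof
  fix x assume "x \<in> I"
  moreover have "1 \<in> colon D I"
    using dom_ideal_subset[OF assms] by (auto simp: colon_def)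
  ultimately have "x * 1 \<in> trace_ideal D I"
    unfolding trace_ideal_def by (rule mod_prodI)
  then show "x \<in> trace_ideal D I"
    by simp
qed

section \<open>Localizations\<close>

definition loc_module :: "'a::field set \<Rightarrow> 'a set \<Rightarrow> 'a set \<Rightarrow> 'a set" where
  "loc_module D P A = {a / s | a s. a \<in> A \<and> s \<in> D \<and> s \<notin> P}"

lemma loc_moduleI: "a \<in> A \<Longrightarrow> s \<in> D \<Longrightarrow> s \<notin> P \<Longrightarrow> a / s \<in> loc_module D P A"
  by (auto simp: loc_module_def)

lemma loc_moduleE:
  assumes "x \<in> loc_module D P A"
  obtains a s where "a \<in> A" "s \<in> D" "s \<notin> P" "x = a / s"
  using assms by (auto simp: loc_module_def)

lemma loc_eq_loc_module: "loc D P = loc_module D P D"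
  by (simp add: loc_def loc_module_def)

lemma locI: "a \<in> D \<Longrightarrow> s \<in> D \<Longrightarrow> s \<notin> P \<Longrightarrow> a / s \<in> loc D P"
  unfolding loc_eq_loc_module by (rule loc_moduleI)

lemma locE:
  assumes "x \<in> loc D P"
  obtains a s where "a \<in> D" "s \<in> D" "s \<notin> P" "x = a / s"
  using assms unfolding loc_eq_loc_module by (rule loc_moduleE)

lemma loc_antimono: "P \<subseteq> Q \<Longrightarrow> loc D Q \<subseteq> loc D P"
  by (auto simp: loc_def)

context
  fixes D P :: "'a::field set"
  assumes D: "is_subring D" and P: "dom_prime D P"
begin

lemma denominator_nonzero: "s \<notin> P \<Longrightarrow> s \<noteq> 0"
  using submod_zero[OF dom_prime_submod[OF P]] by blast

lemma denominator_mult: "s \<in> D \<Longrightarrow> s \<notin> P \<Longrightarrow> t \<in> D \<Longrightarrow> t \<notin> P \<Longrightarrow> s * t \<in> D \<and> s * t \<notin> P"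
  using dom_prime_multD[OF P] subring_mult[OF D] by blast

lemma loc_module_superset: "A \<subseteq> loc_module D P A"
  using loc_moduleI[of _ A 1 D P] subring_one[OF D] dom_prime_one_notin[OF P] by auto

lemma submod_loc_module:
  assumes A: "submod D A"
  shows "submod (loc D P) (loc_module D P A)"
  unfolding submod_def
proof (intro conjI ballI)
  show "0 \<in> loc_module D P A"
    using loc_module_superset submod_zero[OF A] by blast
  fix x assume "x \<in> loc_module D P A"
  then obtain a s where x: "a \<in> A" "s \<in> D" "s \<notin> P" "x = a / s"
    by (rule loc_moduleE)
  show "x + y \<in> loc_module D P A" if "y \<in> loc_module D P A" for y
    using that
  proof (rule loc_moduleE)
    fix b t assume y: "b \<in> A" "t \<in> D" "t \<notin> P" "y = b / t"
    have "x + y = (t * a + s * b) / (s * t)"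
      using x(3,4) y(3,4) by (simp add: add_frac_eq denominator_nonzero mult.commute)
    moreover have "t * a + s * b \<in> A"
      by (intro submod_add[OF A] submod_mult[OF A] x y)
    ultimately show ?thesis
      using denominator_mult[OF x(2,3) y(2,3)] by (simp add: loc_moduleI)
  qed
  show "r * x \<in> loc_module D P A" if "r \<in> loc D P" for r
    using that
  proof (rule locE)
    fix b t assume r: "b \<in> D" "t \<in> D" "t \<notin> P" "r = b / t"
    have "r * x = (b * a) / (t * s)"
      using x(4) r(4) by simp
    then show ?thesis
      using denominator_mult[OF r(2,3) x(2,3)] submod_mult[OF A r(1) x(1)] by (simp add: loc_moduleI)
  qed
qed

lemma loc_superset: "D \<subseteq> loc D P"
  unfolding loc_eq_loc_module by (rule loc_module_superset)

lemma is_subring_loc: "is_subring (loc D P)"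
  unfolding is_subring_iff_submod
  using submod_loc_module[OF submod_self[OF D]] loc_superset subring_one[OF D] subring_uminus[OF D]
  by (auto simp flip: loc_eq_loc_module)

lemma numerator_in_prime:
  assumes "a / s \<in> loc_module D P P" "a \<in> D" "s \<in> D" "s \<notin> P"
  shows "a \<in> P"
  using assms(1)
proof (rule loc_moduleE)
  fix c e assume "c \<in> P" "e \<in> D" "e \<notin> P" "a / s = c / e"
  then have "a * e = s * c"
    using \<open>s \<notin> P\<close> by (simp add: frac_eq_eq denominator_nonzero mult.commute)
  then have "a * e \<in> P"
    using submod_mult[OF dom_prime_submod[OF P] \<open>s \<in> D\<close> \<open>c \<in> P\<close>] by simp
  then show ?thesis
    using dom_prime_multD[OF P] assms(2) \<open>e \<in> D\<close> \<open>e \<notin> P\<close> by blast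
qed

lemma loc_module_prime_Int: "loc_module D P P \<inter> D = P"
proof
  show "P \<subseteq> loc_module D P P \<inter> D"
    using loc_module_superset dom_prime_subset[OF P] by blast
  show "loc_module D P P \<inter> D \<subseteq> P"
    using numerator_in_prime[of _ 1] subring_one[OF D] dom_prime_one_notin[OF P] by auto
qed

lemma dom_prime_loc_module: "dom_prime (loc D P) (loc_module D P P)"
proof (rule dom_primeI)
  show "dom_ideal (loc D P) (loc_module D P P)"
    using submod_loc_module[OF dom_prime_submod[OF P]] dom_prime_subset[OF P]
    by (auto simp: dom_ideal_iff_submod loc_def loc_module_def)
  show "1 \<in> loc D P"
    by (rule subring_one[OF is_subring_loc])
  show "1 \<notin> loc_module D P P"
    using loc_module_prime_Int subring_one[OF D] dom_prime_one_notin[OF P] by blast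
  fix x y assume x: "x \<in> loc D P" and y: "y \<in> loc D P" and xy: "x * y \<in> loc_module D P P"
  obtain a s where as: "a \<in> D" "s \<in> D" "s \<notin> P" "x = a / s"
    using x by (rule locE)
  obtain b t where bt: "b \<in> D" "t \<in> D" "t \<notin> P" "y = b / t"
    using y by (rule locE)
  have "a * b \<in> P"
    using numerator_in_prime[of "a * b" "s * t"] xy as bt denominator_mult subring_mult[OF D] by simp
  then show "x \<in> loc_module D P P \<or> y \<in> loc_module D P P"
    using dom_prime_multD[OF P] as bt loc_moduleI by blast
qed

lemma mem_prime_iff_loc:
  assumes "x \<in> D"
  shows "x \<in> P \<longleftrightarrow> x = 0 \<or> inverse x \<notin> loc D P"
proof (cases "x = 0")
  case True
  then show ?thesis
    by (simp add: submod_zero[OF dom_prime_submod[OF P]])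
next
  case False
  have "inverse x \<notin> loc D P" if "x \<in> P"
  proof
    assume "inverse x \<in> loc D P"
    then have "inverse x * x \<in> loc_module D P P"
      using submod_mult[OF submod_loc_module[OF dom_prime_submod[OF P]]] that loc_module_superset by blast
    then show False
      using False dom_prime_one_notin[OF dom_prime_loc_module] by simp
  qed
  moreover have "inverse x \<in> loc D P" if "x \<notin> P"
    using locI[of 1 D x P] that assms subring_one[OF D] by (simp add: inverse_eq_divide)
  ultimately show ?thesis
    using False by blast
qed

lemma loc_ne_UNIV:
  assumes "P \<noteq> {0}"
  shows "loc D P \<noteq> UNIV"
proof -
  obtain p where "p \<in> P" "p \<noteq> 0"
    using submod_nonzeroE[OF dom_prime_submod[OF P] assms] .
  then show ?thesis
    using mem_prime_iff_loc[of p] dom_prime_subset[OF P] by blast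
qed

lemma prime_of_overring_below_loc:
  assumes T: "overring D T" "T \<subseteq> loc D P"
  obtains Q where "dom_prime T Q" "Q \<inter> D = P"
proof
  show "dom_prime T (loc_module D P P \<inter> T)"
    using dom_prime_contraction[OF dom_prime_loc_module overring_subring[OF T(1)] T(2)] .
  show "loc_module D P P \<inter> T \<inter> D = P"
    using loc_module_prime_Int overring_superset[OF T(1)] by blast
qed

lemma finite_common_denominator:
  assumes "finite S" "S \<subseteq> loc D P"
  obtains t where "t \<in> D" "t \<notin> P" "\<forall>s\<in>S. t * s \<in> D"
proof -
  have "\<exists>t. t \<in> D \<and> t \<notin> P \<and> (\<forall>s\<in>S. t * s \<in> D)"
    using assms
  proof (induction S rule: finite_induct)
    case empty
    then show ?case
      using subring_one[OF D] dom_prime_one_notin[OF P] by blast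
  next
    case (insert x S)
    then obtain t where t: "t \<in> D" "t \<notin> P" "\<forall>s\<in>S. t * s \<in> D"
      by auto
    have "x \<in> loc D P"
      using insert.prems by simp
    then obtain a e where x: "a \<in> D" "e \<in> D" "e \<notin> P" "x = a / e"
      by (rule locE)
    have "e * t * x = t * a"
      using x(3,4) by (simp add: denominator_nonzero)
    then have "e * t * x \<in> D"
      using subring_mult[OF D t(1) x(1)] by metis
    moreover have "e * t * s \<in> D" if "s \<in> S" for s
      using subring_mult[OF D x(2), of "t * s"] t(3) that by (simp add: mult.assoc)
    ultimately show ?case
      using denominator_mult[OF x(2,3) t(1,2)] by (intro exI[of _ "e * t"]) auto
  qed
  then show ?thesis
    using that by blast
qed

end

lemma loc_subset_loc_iff:
  assumes D: "is_subring D" and P: "dom_prime D P" and Q: "dom_prime D Q"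
  shows "loc D P \<subseteq> loc D Q \<longleftrightarrow> Q \<subseteq> P"
proof
  show "Q \<subseteq> P" if "loc D P \<subseteq> loc D Q"
    using mem_prime_iff_loc[OF D P] mem_prime_iff_loc[OF D Q] dom_prime_subset[OF Q] that by blast
qed (rule loc_antimono)

lemma dom_prime_zero: "is_subring D \<Longrightarrow> dom_prime D {0}"
  by (auto simp: dom_prime_def dom_ideal_def subring_zero dest: subring_one)

lemma loc_zero:
  assumes "is_domain_of D"
  shows "loc D {0} = UNIV"
proof -
  have "x \<in> loc D {0}" for x
  proof -
    obtain a b where "a \<in> D" "b \<in> D" "b \<noteq> 0" "x = a / b"
      using assms unfolding is_domain_of_def by blast
    then show ?thesis
      by (auto intro: locI)
  qed
  then show ?thesis
    by blast
qed

section \<open>The t-operation\<close>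

lemma v_op_extensive: "S \<subseteq> v_op R S"
  by (auto simp: v_op_def colon_def mult.commute)

lemma v_op_mono: "S \<subseteq> T \<Longrightarrow> v_op R S \<subseteq> v_op R T"
  unfolding v_op_def by (intro colon_antimono)

lemma colon_v_op: "colon R (v_op R S) = colon R S"
proof
  show "colon R (v_op R S) \<subseteq> colon R S"
    by (intro colon_antimono v_op_extensive)
  show "colon R S \<subseteq> colon R (v_op R S)"
    using v_op_extensive[of "colon R S" R] by (simp add: v_op_def)
qed

lemma v_op_least: "S \<subseteq> v_op R T \<Longrightarrow> v_op R S \<subseteq> v_op R T"
  using v_op_mono[of S "v_op R T" R] by (simp add: v_op_def[of R "v_op R T"] colon_v_op flip: v_op_def)

lemma mem_v_op_iff: "x \<in> v_op R S \<longleftrightarrow> (\<forall>y\<in>colon R S. x * y \<in> R)"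
  by (simp add: v_op_def colon_def[of R "colon R S"])

lemma v_op_scale:
  assumes "x \<in> v_op R S"
  shows "b * x \<in> v_op R ((*) b ` S)"
  unfolding mem_v_op_iff
proof
  fix y assume "y \<in> colon R ((*) b ` S)"
  then have "b * y \<in> colon R S"
    by (simp add: colon_def ac_simps)
  then show "b * x * y \<in> R"
    using assms by (auto simp: mem_v_op_iff ac_simps)
qed

context
  fixes R :: "'a::field set"
  assumes R: "is_subring R"
begin

lemma v_op_generated: "v_op R (mod_prod R S) = v_op R S"
  by (simp add: v_op_def colon_generated[OF R])

lemma v_op_insert_zero: "v_op R (insert 0 S) = v_op R S"
  by (simp add: v_op_def colon_insert_zero[OF R])

lemma submod_v_op: "submod R (v_op R S)"
  unfolding v_op_def by (rule submod_colon[OF R])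

lemma mem_t_op_iff:
  assumes "submod R A"
  shows "x \<in> t_op R A \<longleftrightarrow> (\<exists>S. finite S \<and> S \<subseteq> A \<and> \<not> S \<subseteq> {0} \<and> x \<in> v_op R S)"
proof
  assume "x \<in> t_op R A"
  then obtain S where "finite S" "mod_prod R S \<noteq> {0}" "mod_prod R S \<subseteq> A" "x \<in> v_op R (mod_prod R S)"
    unfolding t_op_def fin_gen_nonzero_def by blast
  then show "\<exists>S. finite S \<and> S \<subseteq> A \<and> \<not> S \<subseteq> {0} \<and> x \<in> v_op R S"
    using assms R by (auto simp: generated_subset_iff generated_eq_zero_iff v_op_generated)
next
  assume "\<exists>S. finite S \<and> S \<subseteq> A \<and> \<not> S \<subseteq> {0} \<and> x \<in> v_op R S"
  then obtain S where S: "finite S" "S \<subseteq> A" "\<not> S \<subseteq> {0}" "x \<in> v_op R S"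
    by blast
  then have "fin_gen_nonzero R (mod_prod R S)" "mod_prod R S \<subseteq> A"
    using assms R by (auto simp: fin_gen_nonzero_def generated_subset_iff generated_eq_zero_iff)
  then show "x \<in> t_op R A"
    using S(4) v_op_generated unfolding t_op_def by blast
qed

lemma mem_t_opI:
  "submod R A \<Longrightarrow> finite S \<Longrightarrow> S \<subseteq> A \<Longrightarrow> \<not> S \<subseteq> {0} \<Longrightarrow> x \<in> v_op R S \<Longrightarrow> x \<in> t_op R A"
  using mem_t_op_iff by blast

lemma mem_t_opE:
  assumes "submod R A" "x \<in> t_op R A"
  obtains S where "finite S" "S \<subseteq> A" "\<not> S \<subseteq> {0}" "x \<in> v_op R S"
  using assms(2) unfolding mem_t_op_iff[OF assms(1)] by (elim exE conjE)

lemma t_op_zero: "t_op R {0} = {}"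
  using mem_t_op_iff[OF submod_singleton_zero] by blast

lemma t_op_extensive:
  assumes "submod R A" "A \<noteq> {0}"
  shows "A \<subseteq> t_op R A"
proof
  fix x assume "x \<in> A"
  obtain a where "a \<in> A" "a \<noteq> 0"
    using submod_nonzeroE[OF assms] .
  then show "x \<in> t_op R A"
    using \<open>x \<in> A\<close> v_op_extensive[of "{x, a}" R] by (intro mem_t_opI[OF assms(1), of "{x, a}"]) auto
qed

lemma finite_subset_t_opE:
  assumes A: "submod R A" "A \<noteq> {0}" and S: "finite S" "S \<subseteq> t_op R A"
  obtains F where "finite F" "F \<subseteq> A" "\<not> F \<subseteq> {0}" "S \<subseteq> v_op R F"
proof -
  have "\<exists>F. finite F \<and> F \<subseteq> A \<and> \<not> F \<subseteq> {0} \<and> S \<subseteq> v_op R F"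
    using S
  proof (induction S rule: finite_induct)
    case empty
    obtain a where "a \<in> A" "a \<noteq> 0"
      using submod_nonzeroE[OF A] .
    then show ?case
      by (intro exI[of _ "{a}"]) auto
  next
    case (insert x S)
    then obtain F where F: "finite F" "F \<subseteq> A" "\<not> F \<subseteq> {0}" "S \<subseteq> v_op R F"
      by blast
    have "x \<in> t_op R A"
      using insert.prems by simp
    then obtain G where G: "finite G" "G \<subseteq> A" "x \<in> v_op R G"
      by (rule mem_t_opE[OF A(1)])
    have "insert x S \<subseteq> v_op R (F \<union> G)"
      using F(4) G(3) v_op_mono[of F "F \<union> G" R] v_op_mono[of G "F \<union> G" R] by blast
    then show ?case
      using F G by (intro exI[of _ "F \<union> G"]) auto
  qed
  then show ?thesis
    using that by blast
qed

lemma submod_t_op: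
  assumes A: "submod R A" "A \<noteq> {0}"
  shows "submod R (t_op R A)"
  unfolding submod_def
proof (intro conjI ballI)
  show "0 \<in> t_op R A"
    using t_op_extensive[OF A] submod_zero[OF A(1)] by blast
  fix x assume x: "x \<in> t_op R A"
  show "x + y \<in> t_op R A" if y: "y \<in> t_op R A" for y
  proof -
    obtain F where F: "finite F" "F \<subseteq> A" "\<not> F \<subseteq> {0}" "{x, y} \<subseteq> v_op R F"
      using finite_subset_t_opE[OF A, of "{x, y}"] x y by auto
    then show ?thesis
      using submod_add[OF submod_v_op] by (intro mem_t_opI[OF A(1) F(1-3)]) simp
  qed
  show "r * x \<in> t_op R A" if "r \<in> R" for r
    using A(1) x
  proof (rule mem_t_opE)
    fix S assume "finite S" "S \<subseteq> A" "\<not> S \<subseteq> {0}" "x \<in> v_op R S"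
    then show ?thesis
      using submod_mult[OF submod_v_op \<open>r \<in> R\<close>] by (intro mem_t_opI[OF A(1), of S])
  qed
qed

lemma t_op_idem:
  assumes A: "submod R A" "A \<noteq> {0}"
  shows "t_op R (t_op R A) = t_op R A"
proof
  have "t_op R A \<noteq> {0}"
    using t_op_extensive[OF A] A by (auto elim: submod_nonzeroE)
  then show "t_op R A \<subseteq> t_op R (t_op R A)"
    by (intro t_op_extensive submod_t_op A)
  show "t_op R (t_op R A) \<subseteq> t_op R A"
  proof
    fix x assume "x \<in> t_op R (t_op R A)"
    then obtain S where S: "finite S" "S \<subseteq> t_op R A" "x \<in> v_op R S"
      by (rule mem_t_opE[OF submod_t_op[OF A]])
    obtain F where F: "finite F" "F \<subseteq> A" "\<not> F \<subseteq> {0}" "S \<subseteq> v_op R F"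
      using S(1,2) by (rule finite_subset_t_opE[OF A])
    then show "x \<in> t_op R A"
      using v_op_least[OF F(4)] S(3) by (intro mem_t_opI[OF A(1) F(1-3)]) blast
  qed
qed

lemma t_op_subset_ring:
  assumes "dom_ideal R A"
  shows "t_op R A \<subseteq> R"
proof
  fix x assume "x \<in> t_op R A"
  then obtain S where "S \<subseteq> A" "x \<in> v_op R S"
    by (rule mem_t_opE[OF dom_ideal_submod[OF assms]])
  then have "1 \<in> colon R S" "\<forall>y\<in>colon R S. x * y \<in> R"
    using dom_ideal_subset[OF assms] by (auto simp: colon_def mem_v_op_iff)
  then show "x \<in> R"
    by force
qed

lemma t_idealI: "dom_ideal R I \<Longrightarrow> I \<noteq> {0} \<Longrightarrow> t_op R I \<subseteq> I \<Longrightarrow> t_ideal R I"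
  by (simp add: t_ideal_def subset_antisym t_op_extensive dom_ideal_submod)

lemma t_ideal_t_op:
  assumes "dom_ideal R A" "A \<noteq> {0}"
  shows "t_ideal R (t_op R A)"
proof (rule t_idealI)
  have A: "submod R A" "A \<noteq> {0}"
    using assms by (simp_all add: dom_ideal_submod)
  show "dom_ideal R (t_op R A)"
    using submod_t_op[OF A] t_op_subset_ring[OF assms(1)] by (simp add: dom_ideal_iff_submod)
  show "t_op R A \<noteq> {0}"
    using t_op_extensive[OF A] A by (auto elim: submod_nonzeroE)
  show "t_op R (t_op R A) \<subseteq> t_op R A"
    using t_op_idem[OF A] by simp
qed

end

lemma t_op_mono: "A \<subseteq> B \<Longrightarrow> t_op R A \<subseteq> t_op R B"
  unfolding t_op_def by blast

lemma t_ideal_ideal: "t_ideal R I \<Longrightarrow> dom_ideal R I"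
  by (simp add: t_ideal_def)

lemma t_ideal_submod: "t_ideal R I \<Longrightarrow> submod R I"
  by (intro dom_ideal_submod t_ideal_ideal)

lemma t_ideal_nonzero: "t_ideal R I \<Longrightarrow> I \<noteq> {0}"
  by (simp add: t_ideal_def)

lemma t_op_subset_t_ideal: "t_ideal R I \<Longrightarrow> A \<subseteq> I \<Longrightarrow> t_op R A \<subseteq> I"
  using t_op_mono[of A I R] by (simp add: t_ideal_def)

lemma t_ideal_Union_chain:
  assumes R: "is_subring R" and "\<C> \<noteq> {}" and chain: "subset.chain (Collect (t_ideal R)) \<C>"
  shows "t_ideal R (\<Union>\<C>)"
proof (rule t_idealI[OF R])
  have t_ideal: "t_ideal R J" if "J \<in> \<C>" for J
    using chain that by (auto simp: subset_chain_def)
  have submod: "submod R (\<Union>\<C>)"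
    by (rule submod_Union_chain[OF chain \<open>\<C> \<noteq> {}\<close> t_ideal_submod[OF t_ideal]])
  then show "dom_ideal R (\<Union>\<C>)"
    using t_ideal dom_ideal_subset[OF t_ideal_ideal] by (auto simp: dom_ideal_iff_submod)
  show "\<Union>\<C> \<noteq> {0}"
  proof -
    obtain J where "J \<in> \<C>"
      using \<open>\<C> \<noteq> {}\<close> by blast
    then obtain a where "a \<in> J" "a \<noteq> 0"
      using t_ideal submod_nonzeroE[OF t_ideal_submod t_ideal_nonzero] by metis
    then show ?thesis
      using \<open>J \<in> \<C>\<close> by blast
  qed
  show "t_op R (\<Union>\<C>) \<subseteq> \<Union>\<C>"
  proof
    fix x assume "x \<in> t_op R (\<Union>\<C>)"
    then obtain S where S: "finite S" "S \<subseteq> \<Union>\<C>" "\<not> S \<subseteq> {0}" "x \<in> v_op R S"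
      by (rule mem_t_opE[OF R submod])
    obtain J where J: "J \<in> \<C>" "S \<subseteq> J"
      using S(1,2) \<open>\<C> \<noteq> {}\<close> chain by (rule finite_subset_Union_chain)
    then have "x \<in> t_op R J"
      using S t_ideal by (intro mem_t_opI[OF R t_ideal_submod]) auto
    then show "x \<in> \<Union>\<C>"
      using t_op_subset_t_ideal[OF t_ideal[OF J(1)] order_refl] J(1) by blast
  qed
qed

lemma t_ideal_residual:
  assumes R: "is_subring R" and M: "t_ideal R M" and b: "b \<in> R" "b \<noteq> 0"
  shows "t_ideal R {x \<in> R. b * x \<in> M}" (is "t_ideal R ?J")
proof (rule t_idealI[OF R])
  show ideal: "dom_ideal R ?J"
    by (rule dom_ideal_residual[OF R t_ideal_ideal[OF M]])
  have "M \<subseteq> ?J"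
    using submod_mult[OF t_ideal_submod[OF M] b(1)] dom_ideal_subset[OF t_ideal_ideal[OF M]] by blast
  then show "?J \<noteq> {0}"
    using t_ideal_nonzero[OF M] submod_zero[OF t_ideal_submod[OF M]] by blast
  show "t_op R ?J \<subseteq> ?J"
  proof
    fix x assume x: "x \<in> t_op R ?J"
    then obtain S where S: "finite S" "S \<subseteq> ?J" "\<not> S \<subseteq> {0}" "x \<in> v_op R S"
      by (rule mem_t_opE[OF R dom_ideal_submod[OF ideal]])
    have "b * x \<in> t_op R M"
      using S b(2) by (intro mem_t_opI[OF R t_ideal_submod[OF M], of "(*) b ` S"] v_op_scale) auto
    then show "x \<in> ?J"
      using x M t_op_subset_ring[OF R ideal] by (auto simp: t_ideal_def)
  qed
qed

lemma t_Max_iff: "M \<in> t_Max R \<longleftrightarrow> maximal_proper (t_ideal R) R M"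
  by (simp add: t_Max_def maximal_proper_def)

lemma t_Max_t_ideal: "M \<in> t_Max R \<Longrightarrow> t_ideal R M"
  by (simp add: t_Max_def)

lemma t_Max_prime:
  assumes R: "is_subring R" and M: "M \<in> t_Max R"
  shows "dom_prime R M"
proof (rule maximal_proper_prime[OF R])
  show "maximal_proper (t_ideal R) R M"
    using M by (simp add: t_Max_iff)
  show "t_ideal R {x \<in> R. b * x \<in> M}" if "b \<in> R" "b \<notin> M" for b
    using that submod_zero[OF t_ideal_submod[OF t_Max_t_ideal[OF M]]]
    by (intro t_ideal_residual[OF R t_Max_t_ideal[OF M]]) auto
qed (rule t_ideal_ideal)

lemma t_op_eq_ring_iff:
  assumes R: "is_subring R" and A: "dom_ideal R A" "A \<noteq> {0}"
  shows "t_op R A = R \<longleftrightarrow> (\<forall>M\<in>t_Max R. \<not> A \<subseteq> M)"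
proof
  show "\<forall>M\<in>t_Max R. \<not> A \<subseteq> M" if "t_op R A = R"
  proof (intro ballI notI)
    fix M assume M: "M \<in> t_Max R" "A \<subseteq> M"
    then have "R \<subseteq> M"
      using t_op_subset_t_ideal[OF t_Max_t_ideal] that by blast
    then show False
      using dom_prime_one_notin[OF t_Max_prime[OF R M(1)]] subring_one[OF R] by blast
  qed
  show "t_op R A = R" if "\<forall>M\<in>t_Max R. \<not> A \<subseteq> M"
  proof (rule ccontr)
    assume "t_op R A \<noteq> R"
    with t_ideal_t_op[OF R A] obtain M where "maximal_proper (t_ideal R) R M" "t_op R A \<subseteq> M"
      using maximal_proper_exists[of "t_ideal R" R "t_op R A"] t_ideal_ideal subring_one[OF R]
        t_ideal_Union_chain[OF R] by metis
    then show False
      using that t_op_extensive[OF R dom_ideal_submod[OF A(1)] A(2)] t_Max_iff by blast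
  qed
qed

section \<open>Intersections of localizations\<close>

abbreviation Spec :: "'a::field set \<Rightarrow> 'a set set" where
  "Spec D \<equiv> {P. dom_prime D P}"

abbreviation Max_Spec :: "'a::field set \<Rightarrow> 'a set set" where
  "Max_Spec D \<equiv> {M. dom_maximal D M}"

definition Inter_loc :: "'a::field set \<Rightarrow> 'a set set \<Rightarrow> 'a set" where
  "Inter_loc D \<P> = (\<Inter>P\<in>\<P>. loc D P)"

definition antichains :: "'a set set \<Rightarrow> 'a set set set" where
  "antichains \<S> = {\<P>. \<P> \<subseteq> \<S> \<and> pairwise_incomparable \<P>}"

lemma sharp_domain_iff_inj_on: "sharp_domain D \<longleftrightarrow> inj_on (Inter_loc D) (Pow (Max_Spec D) - {{}})"
  unfolding sharp_domain_def inj_on_def Inter_loc_def[symmetric] by blast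

lemma t_sharp_iff_inj_on: "t_sharp R \<longleftrightarrow> inj_on (Inter_loc R) (Pow (t_Max R))"
  unfolding t_sharp_def inj_on_def Inter_loc_def[symmetric] by blast

lemma t_sharp_sharp_iff_inj_on:
  "t_sharp_sharp R \<longleftrightarrow> inj_on (Inter_loc R) (antichains {P. t_prime R P})"
  unfolding t_sharp_sharp_def inj_on_def Inter_loc_def[symmetric] antichains_def by blast

lemma Max_Spec_subset_Spec: "is_subring D \<Longrightarrow> Max_Spec D \<subseteq> Spec D"
  by (auto intro: dom_maximal_prime)

lemma antichain_eqI: "pairwise_incomparable \<P> \<Longrightarrow> P \<in> \<P> \<Longrightarrow> Q \<in> \<P> \<Longrightarrow> P \<subseteq> Q \<Longrightarrow> P = Q"
  by (simp add: pairwise_incomparable_def)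

lemma pairwise_incomparable_subset_Max_Spec:
  assumes "\<M> \<subseteq> Max_Spec D"
  shows "pairwise_incomparable \<M>"
  using assms by (auto simp: pairwise_incomparable_def dom_maximal_def)

lemma image_antichains:
  assumes f: "\<And>P Q. P \<in> \<S> \<Longrightarrow> Q \<in> \<S> \<Longrightarrow> f P \<subseteq> f Q \<longleftrightarrow> P \<subseteq> Q"
  shows "(`) f ` antichains \<S> = antichains (f ` \<S>)"
proof
  show "(`) f ` antichains \<S> \<subseteq> antichains (f ` \<S>)"
  proof
    fix \<Q> assume "\<Q> \<in> (`) f ` antichains \<S>"
    then obtain \<P> where \<P>: "\<P> \<subseteq> \<S>" "pairwise_incomparable \<P>" "\<Q> = f ` \<P>"
      by (auto simp: antichains_def)
    have "f P = f Q" if "P \<in> \<P>" "Q \<in> \<P>" "f P \<subseteq> f Q" for P Q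
      using f[of P Q] antichain_eqI[OF \<P>(2) that(1,2)] \<P>(1) that by blast
    then show "\<Q> \<in> antichains (f ` \<S>)"
      using \<P>(1) by (auto simp: \<P>(3) antichains_def pairwise_incomparable_def)
  qed
  show "antichains (f ` \<S>) \<subseteq> (`) f ` antichains \<S>"
  proof
    fix \<Q> assume \<Q>: "\<Q> \<in> antichains (f ` \<S>)"
    define \<P> where "\<P> = {P \<in> \<S>. f P \<in> \<Q>}"
    have "P = Q" if "P \<in> \<P>" "Q \<in> \<P>" "P \<subseteq> Q" for P Q
    proof -
      have "f P = f Q"
        using \<Q> that f by (intro antichain_eqI[of \<Q>]) (simp_all add: antichains_def \<P>_def)
      then show ?thesis
        using f that unfolding \<P>_def by blast
    qed
    then have "\<P> \<in> antichains \<S>"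
      by (auto simp: antichains_def pairwise_incomparable_def \<P>_def)
    moreover have "\<Q> = f ` \<P>"
      using \<Q> by (auto simp: antichains_def \<P>_def)
    ultimately show "\<Q> \<in> (`) f ` antichains \<S>"
      by blast
  qed
qed

lemma Inter_loc_subset: "P \<in> \<P> \<Longrightarrow> Inter_loc D \<P> \<subseteq> loc D P"
  by (auto simp: Inter_loc_def)

context
  fixes D :: "'a::field set"
  assumes D: "is_subring D"
begin

lemma overring_Inter_loc:
  assumes "\<P> \<subseteq> Spec D"
  shows "overring D (Inter_loc D \<P>)"
proof -
  have loc: "is_subring (loc D P)" "D \<subseteq> loc D P" if "P \<in> \<P>" for P
    using assms that is_subring_loc[OF D] loc_superset[OF D] by blast+
  then have "is_subring (Inter_loc D \<P>)"
    unfolding is_subring_def[of "Inter_loc D \<P>"]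
    by (auto simp: Inter_loc_def subring_zero subring_one subring_add subring_diff subring_mult)
  then show ?thesis
    using loc(2) by (auto simp: overring_def Inter_loc_def)
qed

lemma Inter_loc_ne_UNIV:
  assumes "\<P> \<subseteq> Spec D - {{0}}" "\<P> \<noteq> {}"
  shows "Inter_loc D \<P> \<noteq> UNIV"
  using assms loc_ne_UNIV[OF D] Inter_loc_subset[of _ \<P> D] by blast

lemma inj_on_Inter_loc_minus_empty:
  assumes "\<And>\<P>. \<P> \<in> \<F> \<Longrightarrow> \<P> \<subseteq> Spec D - {{0}}"
  shows "inj_on (Inter_loc D) (\<F> - {{}}) \<longleftrightarrow> inj_on (Inter_loc D) \<F>"
proof
  have "Inter_loc D \<P> \<noteq> Inter_loc D {}" if "\<P> \<in> \<F> - {{}}" for \<P>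
    using Inter_loc_ne_UNIV[of \<P>] assms[of \<P>] that by (simp add: Inter_loc_def[of D "{}"])
  then have "Inter_loc D {} \<notin> Inter_loc D ` (\<F> - {{}})"
    by (metis imageE)
  moreover assume "inj_on (Inter_loc D) (\<F> - {{}})"
  ultimately have "inj_on (Inter_loc D) (insert {} (\<F> - {{}}))"
    unfolding inj_on_insert by simp
  then show "inj_on (Inter_loc D) \<F>"
    by (rule inj_on_subset) blast
qed (auto intro: inj_on_subset)

end

section \<open>Bezout domains\<close>

definition bezout :: "'a::field set \<Rightarrow> bool" where
  "bezout D \<longleftrightarrow> is_subring D \<and> (\<forall>x y. \<exists>z. mod_prod D {x, y} = mod_prod D {z})"

lemma bezout_subring: "bezout D \<Longrightarrow> is_subring D"
  by (simp add: bezout_def)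

lemma bezout_gcdE:
  assumes "bezout D"
  obtains z a b c d where "a \<in> D" "b \<in> D" "c \<in> D" "d \<in> D" "x = a * z" "y = b * z" "z = c * x + d * y"
proof -
  note D = bezout_subring[OF assms]
  obtain z where z: "mod_prod D {x, y} = mod_prod D {z}"
    using assms unfolding bezout_def by blast
  then have "x \<in> mod_prod D {z}" "y \<in> mod_prod D {z}" "z \<in> mod_prod D {x, y}"
    using generated_superset[OF D] by blast+
  then show ?thesis
    using that unfolding generated_singleton[OF D] generated_pair[OF D] by blast
qed

lemma bezout_overring:
  assumes "bezout D" "overring D T"
  shows "bezout T"
proof -
  note T = overring_subring[OF assms(2)] and D = bezout_subring[OF assms(1)]
  have "\<exists>z. mod_prod T {x, y} = mod_prod T {z}" for x y
  proof -
    obtain z where z: "mod_prod D {x, y} = mod_prod D {z}"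
      using assms(1) unfolding bezout_def by blast
    have "{x, y} \<subseteq> mod_prod D {z}" "{z} \<subseteq> mod_prod D {x, y}"
      using z generated_superset[OF D] by blast+
    moreover have "mod_prod D S \<subseteq> mod_prod T S" for S
      by (intro mod_prod_mono overring_superset[OF assms(2)] order_refl)
    ultimately show ?thesis
      by (intro exI[of _ z] generated_eqI[OF T]) blast+
  qed
  then show ?thesis
    by (simp add: bezout_def T)
qed

lemma bezout_coprime_fractionE:
  assumes "bezout D"
  obtains a b c d where "a \<in> D" "b \<in> D" "c \<in> D" "d \<in> D" "a \<noteq> 0" "x = b / a" "c * a + d * b = 1"
proof -
  obtain z a b c d where gcd: "a \<in> D" "b \<in> D" "c \<in> D" "d \<in> D" "1 = a * z" "x = b * z" "z = c * 1 + d * x"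
    by (rule bezout_gcdE[OF assms])
  have "a \<noteq> 0"
    using gcd(5) by auto
  then have z: "z = 1 / a"
    using gcd(5) by (simp add: field_simps)
  have "c * a + d * b = a * (c * 1 + d * (b * z))"
    using \<open>a \<noteq> 0\<close> by (simp add: z field_simps)
  also have "\<dots> = 1"
    using gcd(5-7) by metis
  finally show ?thesis
    using that[OF gcd(1-4) \<open>a \<noteq> 0\<close>] gcd(6) z by simp
qed

lemma coprime_not_both_in_prime:
  assumes P: "dom_prime D P" and "c \<in> D" "d \<in> D" "c * a + d * b = 1"
  shows "a \<notin> P \<or> b \<notin> P"
proof (rule ccontr)
  assume "\<not> ?thesis"
  then have "c * a + d * b \<in> P"
    using assms(2,3) by (intro submod_add[OF dom_prime_submod[OF P]] submod_mult[OF dom_prime_submod[OF P]]) auto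
  then show False
    using dom_prime_one_notin[OF P] assms(4) by simp
qed

lemma coprime_fraction_mem_loc_iff:
  assumes D: "is_subring D" and P: "dom_prime D P"
    and ab: "a \<in> D" "b \<in> D" "a \<noteq> 0" and cd: "c \<in> D" "d \<in> D" "c * a + d * b = 1"
  shows "b / a \<in> loc D P \<longleftrightarrow> a \<notin> P"
proof
  assume "b / a \<in> loc D P"
  then obtain u s where us: "u \<in> D" "s \<in> D" "s \<notin> P" "b / a = u / s"
    by (rule locE)
  show "a \<notin> P"
  proof
    assume "a \<in> P"
    have "b * s = u * a"
      using us(3,4) ab(3) by (simp add: frac_eq_eq denominator_nonzero[OF D P])
    then have "b * s \<in> P"
      using submod_mult[OF dom_prime_submod[OF P] us(1) \<open>a \<in> P\<close>] by simp
    then have "b \<in> P"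
      using dom_prime_multD[OF P] us(2,3) ab(2) by blast
    then show False
      using coprime_not_both_in_prime[OF P cd] \<open>a \<in> P\<close> by blast
  qed
qed (auto intro: locI ab)

lemma bezout_primes_comparable:
  assumes D: "bezout D" and N: "dom_prime D N" and P: "dom_prime D P" "P \<subseteq> N" and Q: "dom_prime D Q" "Q \<subseteq> N"
  shows "P \<subseteq> Q \<or> Q \<subseteq> P"
proof (rule ccontr)
  assume "\<not> ?thesis"
  then obtain p q where p: "p \<in> P" "p \<notin> Q" and q: "q \<in> Q" "q \<notin> P"
    by blast
  have pq: "p \<in> D" "q \<in> D"
    using p q dom_prime_subset[OF P(1)] dom_prime_subset[OF Q(1)] by blast+
  obtain a b c d where ab: "a \<in> D" "b \<in> D" "a \<noteq> 0" "p / q = b / a" and cd: "c \<in> D" "d \<in> D" "c * a + d * b = 1"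
    using bezout_coprime_fractionE[OF D] by metis
  have "q \<noteq> 0"
    using q(2) denominator_nonzero[OF bezout_subring[OF D] P(1)] by blast
  then have cross: "p * a = b * q" "q * b = a * p"
    using ab(3,4) by (simp_all add: frac_eq_eq mult.commute)
  have "p * a \<in> Q" "q * b \<in> P"
    unfolding cross using ab p q
    by (auto intro: submod_mult[OF dom_prime_submod[OF P(1)]] submod_mult[OF dom_prime_submod[OF Q(1)]])
  then have "a \<in> N" "b \<in> N"
    using dom_prime_multD[OF P(1)] dom_prime_multD[OF Q(1)] p q pq ab P(2) Q(2) by blast+
  then show False
    using coprime_not_both_in_prime[OF N cd] by blast
qed

context
  fixes D T :: "'a::field set"
  assumes D: "bezout D" and T: "overring D T"
begin

lemma loc_overring_eq_loc_contraction:
  assumes Q: "dom_prime T Q"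
  shows "loc T Q = loc D (Q \<inter> D)"
proof
  show "loc D (Q \<inter> D) \<subseteq> loc T Q"
    using overring_superset[OF T] unfolding loc_def by blast
  show "loc T Q \<subseteq> loc D (Q \<inter> D)"
  proof
    fix x assume "x \<in> loc T Q"
    obtain a b c d where ab: "a \<in> D" "b \<in> D" "a \<noteq> 0" and x: "x = b / a"
      and cd: "c \<in> D" "d \<in> D" "c * a + d * b = 1"
      using bezout_coprime_fractionE[OF D] by metis
    have "a \<notin> Q"
      using coprime_fraction_mem_loc_iff[OF overring_subring[OF T] Q] ab cd x \<open>x \<in> loc T Q\<close>
        overring_superset[OF T] by blast
    then show "x \<in> loc D (Q \<inter> D)"
      unfolding x using ab by (intro locI) auto
  qed
qed

lemma Inter_loc_overring:
  assumes "\<Q> \<subseteq> Spec T"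
  shows "Inter_loc D ((\<lambda>Q. Q \<inter> D) ` \<Q>) = Inter_loc T \<Q>"
  unfolding Inter_loc_def image_image
  using loc_overring_eq_loc_contraction assms by (intro INF_cong) auto

lemma contraction_subset_iff:
  assumes P: "dom_prime T P" and Q: "dom_prime T Q"
  shows "P \<inter> D \<subseteq> Q \<inter> D \<longleftrightarrow> P \<subseteq> Q"
proof
  assume "P \<inter> D \<subseteq> Q \<inter> D"
  then have "loc T Q \<subseteq> loc T P"
    unfolding loc_overring_eq_loc_contraction[OF P] loc_overring_eq_loc_contraction[OF Q] by (rule loc_antimono)
  then show "P \<subseteq> Q"
    using loc_subset_loc_iff[OF overring_subring[OF T] Q P] by blast
qed blast

lemma contraction_image_Spec: "(\<lambda>Q. Q \<inter> D) ` Spec T = {P \<in> Spec D. T \<subseteq> loc D P}"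
proof
  show "(\<lambda>Q. Q \<inter> D) ` Spec T \<subseteq> {P \<in> Spec D. T \<subseteq> loc D P}"
    using dom_prime_contraction[OF _ bezout_subring[OF D] overring_superset[OF T]]
      loc_overring_eq_loc_contraction loc_superset[OF overring_subring[OF T]] by blast
  show "{P \<in> Spec D. T \<subseteq> loc D P} \<subseteq> (\<lambda>Q. Q \<inter> D) ` Spec T"
  proof
    fix P assume P: "P \<in> {P \<in> Spec D. T \<subseteq> loc D P}"
    then obtain Q where "dom_prime T Q" "Q \<inter> D = P"
      using prime_of_overring_below_loc[OF bezout_subring[OF D] _ T, of P] by blast
    then show "P \<in> (\<lambda>Q. Q \<inter> D) ` Spec T"
      by blast
  qed
qed

lemma contraction_antichains:
  "(`) (\<lambda>Q. Q \<inter> D) ` antichains (Spec T) = antichains {P \<in> Spec D. T \<subseteq> loc D P}"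
  unfolding contraction_image_Spec[symmetric]
  by (intro image_antichains contraction_subset_iff) simp_all

end

definition isolates :: "'a::field set \<Rightarrow> 'a \<Rightarrow> 'a set \<Rightarrow> bool" where
  "isolates D a N \<longleftrightarrow> dom_maximal D N \<and> a \<in> N \<and> (\<forall>N'. dom_maximal D N' \<and> a \<in> N' \<longrightarrow> N' = N)"

lemma sharp_isolating_element:
  assumes D: "bezout D" and sharp: "sharp_domain D" and N: "dom_maximal D N"
  obtains a where "isolates D a N"
proof (cases "Max_Spec D = {N}")
  case True
  have "0 \<in> N"
    using submod_zero[OF dom_prime_submod[OF dom_maximal_prime[OF bezout_subring[OF D] N]]] .
  then show ?thesis
    using that[of 0] True N by (auto simp: isolates_def)
next
  case False
  note sub = bezout_subring[OF D]
  have "Max_Spec D - {N} \<noteq> {}"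
    using False N by blast
  then have "Inter_loc D (Max_Spec D - {N}) \<noteq> Inter_loc D (Max_Spec D)"
    using inj_onD[OF sharp[unfolded sharp_domain_iff_inj_on], of "Max_Spec D - {N}" "Max_Spec D"] N by blast
  then obtain x where x: "x \<notin> loc D N" "\<And>N'. dom_maximal D N' \<Longrightarrow> N' \<noteq> N \<Longrightarrow> x \<in> loc D N'"
    using N by (auto simp: Inter_loc_def)
  obtain a b c d where ab: "a \<in> D" "b \<in> D" "a \<noteq> 0" and cd: "c \<in> D" "d \<in> D" "c * a + d * b = 1"
    and xab: "x = b / a"
    using bezout_coprime_fractionE[OF D] by metis
  have "x \<in> loc D N' \<longleftrightarrow> a \<notin> N'" if "dom_maximal D N'" for N'
    unfolding xab using coprime_fraction_mem_loc_iff[OF sub dom_maximal_prime[OF sub that] ab cd] .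
  then have "isolates D a N"
    using x N by (auto simp: isolates_def)
  then show ?thesis
    by (rule that)
qed

definition represents :: "'a::field set \<Rightarrow> 'a set set \<Rightarrow> bool" where
  "represents D \<P> \<longleftrightarrow> \<P> \<subseteq> Spec D \<and> \<P> \<noteq> {} \<and> Inter_loc D \<P> = D"

lemma prime_subset_Union_representing:
  assumes D: "is_subring D" and \<P>: "represents D \<P>" and Q: "dom_prime D Q"
  shows "Q \<subseteq> \<Union>\<P>"
proof
  fix c assume c: "c \<in> Q"
  show "c \<in> \<Union>\<P>"
  proof (cases "c = 0")
    case True
    then show ?thesis
      using \<P> submod_zero[OF dom_prime_submod] unfolding represents_def by blast
  next
    case False
    have "inverse c \<notin> D"
    proof
      assume "inverse c \<in> D"
      then have "inverse c * c \<in> Q"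
        using submod_mult[OF dom_prime_submod[OF Q]] c by blast
      then show False
        using False dom_prime_one_notin[OF Q] by simp
    qed
    then obtain P where "P \<in> \<P>" "inverse c \<notin> loc D P"
      using \<P> unfolding represents_def Inter_loc_def by blast
    then show ?thesis
      using mem_prime_iff_loc[OF D, of P c] \<P> dom_prime_subset[OF Q] c unfolding represents_def by blast
  qed
qed

context
  fixes D :: "'a::field set" and N a
  assumes D: "bezout D" and N: "isolates D a N"
begin

lemma prime_containing_isolating_element:
  assumes "dom_prime D P" "a \<in> P"
  shows "P \<subseteq> N"
  using prime_in_maximal[OF bezout_subring[OF D] assms(1)] N assms(2) unfolding isolates_def by (metis subsetD)

lemma representing_prime_below_isolated:
  assumes \<Q>: "represents D \<Q>"
  obtains Q where "Q \<in> \<Q>" "a \<in> Q" "Q \<subseteq> N"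
proof -
  note sub = bezout_subring[OF D]
  have "a \<in> \<Union>\<Q>"
    using prime_subset_Union_representing[OF sub \<Q> dom_maximal_prime[OF sub]] N unfolding isolates_def by blast
  then show ?thesis
    using that prime_containing_isolating_element \<Q> unfolding represents_def by blast
qed

lemma antichain_primes_below_isolated_eq:
  assumes "\<Q> \<subseteq> Spec D" "pairwise_incomparable \<Q>" "P \<in> \<Q>" "P \<subseteq> N" "Q \<in> \<Q>" "Q \<subseteq> N"
  shows "P = Q"
proof -
  have "dom_prime D N"
    using N dom_maximal_prime[OF bezout_subring[OF D]] by (simp add: isolates_def)
  then have "P \<subseteq> Q \<or> Q \<subseteq> P"
    using bezout_primes_comparable[OF D] assms by blast
  then show ?thesis
    using antichain_eqI[OF assms(2)] assms(3,5) by blast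
qed

text \<open>A generator of \<open>(a, b)\<close> with \<open>b \<in> Q - P\<close> lies in \<open>Q\<close> but would avoid every member of \<open>\<Q>\<close>.\<close>

lemma representing_prime_below_isolated_maximal:
  assumes \<Q>: "represents D \<Q>" "pairwise_incomparable \<Q>" and P: "P \<in> \<Q>" "P \<subseteq> N"
    and Q: "dom_prime D Q" "P \<subseteq> Q"
  shows "Q = P"
proof (rule ccontr)
  assume "Q \<noteq> P"
  then obtain b where b: "b \<in> Q" "b \<notin> P"
    using Q(2) by blast
  have prime: "\<Q> \<subseteq> Spec D"
    using \<Q>(1) by (simp add: represents_def)
  have unique: "P' = P" if "P' \<in> \<Q>" "a \<in> P'" for P'
    using antichain_primes_below_isolated_eq[OF prime \<Q>(2) that(1) _ P]
      prime_containing_isolating_element prime that by blast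
  then have "a \<in> P"
    using representing_prime_below_isolated[OF \<Q>(1)] by metis
  obtain c u v r s where gcd: "u \<in> D" "v \<in> D" "r \<in> D" "s \<in> D" "a = u * c" "b = v * c" "c = r * a + s * b"
    by (rule bezout_gcdE[OF D])
  have "r * a + s * b \<in> Q"
    using \<open>a \<in> P\<close> Q(2) b(1) gcd(3,4)
    by (intro submod_add[OF dom_prime_submod[OF Q(1)]] submod_mult[OF dom_prime_submod[OF Q(1)]]) auto
  then have "c \<in> Q"
    using gcd(7) by simp
  then obtain P' where P': "P' \<in> \<Q>" "c \<in> P'"
    using prime_subset_Union_representing[OF bezout_subring[OF D] \<Q>(1) Q(1)] by blast
  then have "dom_prime D P'"
    using prime by blast
  then have "a \<in> P'" "b \<in> P'"
    using gcd(1,2,5,6) P'(2) submod_mult[OF dom_prime_submod] by metis+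
  then show False
    using unique[OF P'(1)] b(2) by blast
qed

end

lemma bezout_sharp_representation_unique:
  assumes D: "bezout D" "sharp_domain D"
    and \<P>: "represents D \<P>" "pairwise_incomparable \<P>"
    and \<Q>: "represents D \<Q>" "pairwise_incomparable \<Q>"
  shows "\<P> = \<Q>"
proof -
  have "\<P> \<subseteq> \<Q>"
    if \<P>: "represents D \<P>" "pairwise_incomparable \<P>" and \<Q>: "represents D \<Q>" "pairwise_incomparable \<Q>" for \<P> \<Q>
  proof
    fix P assume P: "P \<in> \<P>"
    then have P_prime: "dom_prime D P"
      using \<P>(1) by (auto simp: represents_def)
    obtain N where N: "dom_maximal D N" "P \<subseteq> N"
      using prime_in_maximal[OF bezout_subring[OF D(1)] P_prime] .
    obtain a where a: "isolates D a N"
      using sharp_isolating_element[OF D N(1)] .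
    obtain Q where Q: "Q \<in> \<Q>" "Q \<subseteq> N"
      using representing_prime_below_isolated[OF D(1) a \<Q>(1)] by metis
    then have Q_prime: "dom_prime D Q"
      using \<Q>(1) by (auto simp: represents_def)
    have "dom_prime D N"
      using dom_maximal_prime[OF bezout_subring[OF D(1)] N(1)] .
    then have "P \<subseteq> Q \<or> Q \<subseteq> P"
      using bezout_primes_comparable[OF D(1) _ P_prime N(2) Q_prime Q(2)] by blast
    then have "P = Q"
      using representing_prime_below_isolated_maximal[OF D(1) a \<P> P N(2) Q_prime]
        representing_prime_below_isolated_maximal[OF D(1) a \<Q> Q P_prime] by blast
    then show "P \<in> \<Q>"
      using Q(1) by simp
  qed
  then show ?thesis
    using \<P> \<Q> by blast
qed

lemma bezout_sharp_sharp_imp_inj_on: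
  assumes D: "bezout D" and sharp: "sharp_sharp_domain D"
  shows "inj_on (Inter_loc D) (antichains (Spec D) - {{}})"
proof (rule inj_onI)
  fix \<P> \<Q> assume \<P>: "\<P> \<in> antichains (Spec D) - {{}}" and \<Q>: "\<Q> \<in> antichains (Spec D) - {{}}"
    and eq: "Inter_loc D \<P> = Inter_loc D \<Q>"
  define T where "T = Inter_loc D \<P>"
  have T: "overring D T"
    unfolding T_def using \<P> by (intro overring_Inter_loc bezout_subring[OF D]) (auto simp: antichains_def)
  let ?c = "\<lambda>Q. Q \<inter> D"
  have lift: "\<exists>\<R>'. \<R> = ?c ` \<R>' \<and> represents T \<R>' \<and> pairwise_incomparable \<R>'"
    if \<R>: "\<R> \<in> antichains (Spec D) - {{}}" "Inter_loc D \<R> = T" for \<R>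
  proof -
    have "\<R> \<in> antichains {P \<in> Spec D. T \<subseteq> loc D P}"
      using \<R> Inter_loc_subset[of _ \<R> D] unfolding antichains_def by blast
    then obtain \<R>' where \<R>': "\<R>' \<in> antichains (Spec T)" "\<R> = ?c ` \<R>'"
      unfolding contraction_antichains[OF D T, symmetric] by blast
    then have "Inter_loc T \<R>' = T"
      using \<R>(2) Inter_loc_overring[OF D T] by (auto simp: antichains_def)
    then show ?thesis
      using \<R> \<R>' by (auto simp: represents_def antichains_def)
  qed
  obtain \<P>' \<Q>' where "\<P> = ?c ` \<P>'" "represents T \<P>'" "pairwise_incomparable \<P>'"
    and "\<Q> = ?c ` \<Q>'" "represents T \<Q>'" "pairwise_incomparable \<Q>'"
    using lift[OF \<P>] lift[OF \<Q>] eq by (metis T_def)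
  moreover have "sharp_domain T"
    using sharp T by (simp add: sharp_sharp_domain_def)
  ultimately show "\<P> = \<Q>"
    using bezout_sharp_representation_unique[OF bezout_overring[OF D T]] by metis
qed

lemma bezout_contraction_Max_Spec_nonzero:
  assumes D: "bezout D" and T: "overring D T" and M: "dom_maximal T M" and "Max_Spec T \<noteq> {M}"
  shows "M \<inter> D \<noteq> {0}"
proof
  assume "M \<inter> D = {0}"
  obtain N where N: "dom_maximal T N" "N \<noteq> M"
    using M \<open>Max_Spec T \<noteq> {M}\<close> by blast
  have prime: "dom_prime T M" "dom_prime T N"
    using M N(1) dom_maximal_prime[OF overring_subring[OF T]] by blast+
  have "0 \<in> N \<inter> D"
    using submod_zero[OF dom_prime_submod[OF prime(2)]] subring_zero[OF bezout_subring[OF D]] by blast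
  then have "M \<subseteq> N"
    using contraction_subset_iff[OF D T prime] \<open>M \<inter> D = {0}\<close> by simp
  then show False
    using M N by (auto simp: dom_maximal_def)
qed

lemma bezout_contraction_Max_Spec_antichain:
  assumes D: "bezout D" and T: "overring D T" and \<R>: "\<R> \<subseteq> Max_Spec T" and not_local: "\<nexists>M. Max_Spec T = {M}"
  shows "(\<lambda>Q. Q \<inter> D) ` \<R> \<in> antichains (Spec D - {{0}})"
proof -
  have "\<R> \<in> antichains (Spec T)"
    using \<R> Max_Spec_subset_Spec[OF overring_subring[OF T]] pairwise_incomparable_subset_Max_Spec[OF \<R>]
    by (auto simp: antichains_def)
  then have "(\<lambda>Q. Q \<inter> D) ` \<R> \<in> antichains {P \<in> Spec D. T \<subseteq> loc D P}"
    unfolding contraction_antichains[OF D T, symmetric] by (rule imageI)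
  moreover have "M \<inter> D \<noteq> {0}" if "M \<in> \<R>" for M
    using that \<R> not_local by (intro bezout_contraction_Max_Spec_nonzero[OF D T]) auto
  ultimately show ?thesis
    by (auto simp: antichains_def)
qed

lemma inj_on_imp_bezout_sharp_sharp:
  assumes D: "bezout D" and inj: "inj_on (Inter_loc D) (antichains (Spec D - {{0}}))"
  shows "sharp_sharp_domain D"
  unfolding sharp_sharp_domain_def sharp_domain_iff_inj_on
proof (intro allI impI inj_onI)
  fix T \<M> \<N> assume T: "overring D T"
    and \<M>: "\<M> \<in> Pow (Max_Spec T) - {{}}" and \<N>: "\<N> \<in> Pow (Max_Spec T) - {{}}"
    and eq: "Inter_loc T \<M> = Inter_loc T \<N>"
  let ?c = "\<lambda>Q. Q \<inter> D"
  have prime: "Max_Spec T \<subseteq> Spec T"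
    using Max_Spec_subset_Spec[OF overring_subring[OF T]] .
  show "\<M> = \<N>"
  proof (cases "\<exists>M. Max_Spec T = {M}")
    case True
    then show ?thesis
      using \<M> \<N> by (auto simp: subset_singleton_iff)
  next
    case False
    have "Inter_loc D (?c ` \<M>) = Inter_loc D (?c ` \<N>)"
      using eq Inter_loc_overring[OF D T] \<M> \<N> prime by auto
    then have "?c ` \<M> = ?c ` \<N>"
      using bezout_contraction_Max_Spec_antichain[OF D T] \<M> \<N> False by (intro inj_onD[OF inj]) auto
    moreover have "inj_on ?c (Spec T)"
      using contraction_subset_iff[OF D T] by (intro inj_onI) (simp add: set_eq_subset)
    moreover have "\<M> \<subseteq> Spec T" "\<N> \<subseteq> Spec T"
      using \<M> \<N> subset_trans[OF _ prime] by simp_all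
    ultimately show ?thesis
      by (simp add: inj_on_image_eq_iff)
  qed
qed

theorem bezout_sharp_sharp_iff_inj_on:
  assumes D: "bezout D"
  shows "sharp_sharp_domain D \<longleftrightarrow> inj_on (Inter_loc D) (antichains (Spec D - {{0}}))"
proof
  assume "sharp_sharp_domain D"
  then have "inj_on (Inter_loc D) (antichains (Spec D) - {{}})"
    by (rule bezout_sharp_sharp_imp_inj_on[OF D])
  then have "inj_on (Inter_loc D) (antichains (Spec D - {{0}}) - {{}})"
    by (rule inj_on_subset) (auto simp: antichains_def)
  then show "inj_on (Inter_loc D) (antichains (Spec D - {{0}}))"
    using inj_on_Inter_loc_minus_empty[OF bezout_subring[OF D], of "antichains (Spec D - {{0}})"]
    by (auto simp: antichains_def)
qed (rule inj_on_imp_bezout_sharp_sharp[OF D])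

section \<open>Extensions in which every element has a content\<close>

locale content_extension =
  fixes \<iota> :: "'k::field \<Rightarrow> 'l::field" and R :: "'k set" and D :: "'l set"
  assumes hom_add: "\<iota> (x + y) = \<iota> x + \<iota> y"
    and hom_mult: "\<iota> (x * y) = \<iota> x * \<iota> y"
    and hom_one: "\<iota> 1 = 1"
    and ring_R: "is_subring R"
    and ring_D: "is_subring D"
    and principal_has_content: "\<exists>S. finite S \<and> mod_prod D {z} = mod_prod D (\<iota> ` S)"
    and finitely_generated_principal: "finite S \<Longrightarrow> \<exists>z. mod_prod D (\<iota> ` S) = mod_prod D {z}"
    and contraction_eq_v_op: "finite S \<Longrightarrow> \<not> S \<subseteq> {0} \<Longrightarrow> \<iota> x \<in> mod_prod D (\<iota> ` S) \<longleftrightarrow> x \<in> v_op R S"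
begin

definition extend :: "'k set \<Rightarrow> 'l set" where
  "extend A = mod_prod D (\<iota> ` A)"

definition contract :: "'l set \<Rightarrow> 'k set" where
  "contract N = {x. \<iota> x \<in> N}"

lemma mem_contract_iff: "x \<in> contract N \<longleftrightarrow> \<iota> x \<in> N"
  by (simp add: contract_def)

lemma hom_zero: "\<iota> 0 = 0"
  using hom_add[of 0 0] by (metis add.right_neutral add_left_cancel)

lemma hom_eq_zero_iff: "\<iota> x = 0 \<longleftrightarrow> x = 0"
proof (cases "x = 0")
  case False
  then have "\<iota> x * \<iota> (inverse x) = 1"
    using hom_mult[of x "inverse x"] hom_one by simp
  then show ?thesis
    using False by auto
qed (simp add: hom_zero)

lemma hom_divide: "y \<noteq> 0 \<Longrightarrow> \<iota> (x / y) = \<iota> x / \<iota> y"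
  using hom_mult[of "x / y" y] hom_eq_zero_iff[of y] by (simp add: field_simps)

lemma hom_power: "\<iota> (x ^ n) = \<iota> x ^ n"
  by (induction n) (simp_all add: hom_one hom_mult)

lemma submod_extend: "submod D (extend A)"
  unfolding extend_def by (rule submod_generated[OF ring_D])

lemma extend_subset_iff: "submod D N \<Longrightarrow> extend A \<subseteq> N \<longleftrightarrow> A \<subseteq> contract N"
  unfolding extend_def contract_def using generated_subset_iff[OF ring_D] by auto

lemma subset_contract_extend: "A \<subseteq> contract (extend A)"
  using extend_subset_iff[OF submod_extend] by blast

lemma extend_mono: "A \<subseteq> B \<Longrightarrow> extend A \<subseteq> extend B"
  unfolding extend_def by (intro mod_prod_mono image_mono order_refl)

lemma contract_mono: "N \<subseteq> N' \<Longrightarrow> contract N \<subseteq> contract N'"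
  by (auto simp: contract_def)

lemma contract_ring: "contract D = R"
proof -
  have "\<iota> x \<in> D \<longleftrightarrow> x \<in> R" for x
  proof -
    have "\<iota> x \<in> D \<longleftrightarrow> \<iota> x \<in> mod_prod D (\<iota> ` {1})"
      by (simp add: generated_singleton[OF ring_D] hom_one)
    also have "\<dots> \<longleftrightarrow> x \<in> v_op R {1}"
      by (intro contraction_eq_v_op) auto
    also have "\<dots> \<longleftrightarrow> x \<in> R"
      using subring_one[OF ring_R] subring_mult[OF ring_R] by (force simp: mem_v_op_iff colon_def)
    finally show ?thesis .
  qed
  then show ?thesis
    by (simp add: contract_def)
qed

lemma hom_mem_ring_iff: "\<iota> x \<in> D \<longleftrightarrow> x \<in> R"
  using contract_ring by (auto simp: contract_def)

lemma extend_contract: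
  assumes N: "submod D N"
  shows "extend (contract N) = N"
proof
  show "extend (contract N) \<subseteq> N"
    using extend_subset_iff[OF N] by blast
  show "N \<subseteq> extend (contract N)"
  proof
    fix z assume "z \<in> N"
    obtain S where S: "mod_prod D {z} = mod_prod D (\<iota> ` S)"
      using principal_has_content by blast
    then have "mod_prod D (\<iota> ` S) \<subseteq> N"
      using \<open>z \<in> N\<close> generated_subset_iff[OF ring_D N, of "{z}"] by simp
    then have "S \<subseteq> contract N"
      using extend_subset_iff[OF N] by (simp add: extend_def)
    then show "z \<in> extend (contract N)"
      using extend_mono[of S "contract N"] S generated_superset[OF ring_D, of "{z}"] by (auto simp: extend_def)
  qed
qed

lemma contract_subset_iff: "submod D N \<Longrightarrow> submod D N' \<Longrightarrow> contract N \<subseteq> contract N' \<longleftrightarrow> N \<subseteq> N'"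
  using extend_contract extend_mono contract_mono by metis

lemma contract_eq_iff: "submod D N \<Longrightarrow> submod D N' \<Longrightarrow> contract N = contract N' \<longleftrightarrow> N = N'"
  using extend_contract by metis

lemma contract_eq_ring_iff: "submod D N \<Longrightarrow> contract N = R \<longleftrightarrow> N = D"
  using contract_eq_iff[OF _ submod_self[OF ring_D]] contract_ring by simp

lemma contract_eq_zero_iff:
  assumes "submod D N"
  shows "contract N = {0} \<longleftrightarrow> N = {0}"
proof -
  have "contract {0} = {0}"
    by (simp add: contract_def hom_eq_zero_iff)
  then show ?thesis
    using contract_eq_iff[OF assms submod_singleton_zero] by simp
qed

lemma submod_contract: "submod D N \<Longrightarrow> submod R (contract N)"
  by (auto simp: submod_def contract_def hom_zero hom_add hom_mult hom_mem_ring_iff)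

lemma dom_ideal_contract: "dom_ideal D N \<Longrightarrow> dom_ideal R (contract N)"
  unfolding dom_ideal_iff_submod using submod_contract contract_mono[of N D] contract_ring by simp

lemma dom_ideal_extend: "A \<subseteq> R \<Longrightarrow> dom_ideal D (extend A)"
  by (simp add: dom_ideal_iff_submod submod_extend extend_subset_iff submod_self ring_D contract_ring)

lemma extend_nonzero: "submod R A \<Longrightarrow> A \<noteq> {0} \<Longrightarrow> extend A \<noteq> {0}"
  using subset_contract_extend[of A] contract_eq_zero_iff[OF submod_extend[of A]] submod_zero[of R A] by blast

lemma contract_extend:
  assumes A: "submod R A" "A \<noteq> {0}"
  shows "contract (extend A) = t_op R A"
proof
  show "contract (extend A) \<subseteq> t_op R A"
  proof
    fix x assume "x \<in> contract (extend A)"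
    then have "finite {\<iota> x}" "{\<iota> x} \<subseteq> mod_prod D (\<iota> ` A)"
      by (simp_all add: contract_def extend_def)
    then obtain S' where "finite S'" "S' \<subseteq> \<iota> ` A" and x: "{\<iota> x} \<subseteq> mod_prod D S'"
      by (rule finite_subset_mod_prodE)
    then obtain S where S: "finite S" "S \<subseteq> A" "S' = \<iota> ` S"
      by (meson finite_subset_image)
    obtain a where a: "a \<in> A" "a \<noteq> 0"
      using submod_nonzeroE[OF A] .
    have "\<iota> x \<in> mod_prod D (\<iota> ` insert a S)"
      using x S(3) mod_prod_mono[of D D S' "\<iota> ` insert a S"] by auto
    then have "x \<in> v_op R (insert a S)"
      using contraction_eq_v_op[of "insert a S"] S(1) a(2) by auto
    then show "x \<in> t_op R A"
      using S a by (intro mem_t_opI[OF ring_R A(1), of "insert a S"]) auto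
  qed
  show "t_op R A \<subseteq> contract (extend A)"
  proof
    fix x assume "x \<in> t_op R A"
    then obtain S where S: "finite S" "S \<subseteq> A" "\<not> S \<subseteq> {0}" "x \<in> v_op R S"
      by (rule mem_t_opE[OF ring_R A(1)])
    then have "x \<in> contract (extend S)"
      using contraction_eq_v_op[OF S(1,3)] by (simp add: contract_def extend_def)
    then show "x \<in> contract (extend A)"
      using contract_mono[OF extend_mono[OF S(2)]] by blast
  qed
qed

lemma contract_extend_t_ideal: "t_ideal R A \<Longrightarrow> contract (extend A) = A"
  using contract_extend[of A] by (simp add: t_ideal_def dom_ideal_submod)

lemma t_ideal_contract:
  assumes N: "dom_ideal D N" "N \<noteq> {0}"
  shows "t_ideal R (contract N)"
proof -
  have contract_N: "submod R (contract N)" "contract N \<noteq> {0}"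
    using N by (simp_all add: dom_ideal_submod submod_contract contract_eq_zero_iff)
  have "t_op R (contract N) = contract N"
    using contract_extend[OF contract_N] extend_contract[OF dom_ideal_submod[OF N(1)]] by simp
  then show ?thesis
    using N(1) contract_N(2) by (simp add: t_ideal_def dom_ideal_contract)
qed

lemma t_ideal_extend:
  assumes "t_ideal R A"
  shows "dom_ideal D (extend A)" "extend A \<noteq> {0}"
  using assms dom_ideal_extend extend_nonzero by (auto simp: t_ideal_def dom_ideal_iff_submod)

subsection \<open>Products, colons and radicals\<close>

lemma mod_prod_extend: "mod_prod (extend A) (extend B) = extend (mod_prod A B)"
proof -
  let ?AB = "{a * b | a b. a \<in> A \<and> b \<in> B}"
  have "mod_prod (extend A) (extend B) = mod_prod D {x * y | x y. x \<in> \<iota> ` A \<and> y \<in> \<iota> ` B}"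
    unfolding extend_def by (rule mod_prod_generated[OF ring_D])
  also have "{x * y | x y. x \<in> \<iota> ` A \<and> y \<in> \<iota> ` B} = \<iota> ` ?AB"
    by (auto simp: image_iff) (metis hom_mult)+
  also have "mod_prod D (\<iota> ` ?AB) = extend ?AB"
    by (simp add: extend_def)
  also have "\<dots> = extend (mod_prod A B)"
  proof
    show "extend ?AB \<subseteq> extend (mod_prod A B)"
      by (intro extend_mono) (auto intro: mod_prodI)
    have "a * b \<in> contract (extend ?AB)" if "a \<in> A" "b \<in> B" for a b
      using that subset_contract_extend[of ?AB] by blast
    then have "mod_prod A B \<subseteq> contract (extend ?AB)"
      by (rule mod_prod_least[OF submod_contract[OF submod_extend]])
    then show "extend (mod_prod A B) \<subseteq> extend ?AB"
      by (simp add: extend_subset_iff submod_extend)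
  qed
  finally show ?thesis .
qed

lemma colon_extend: "colon D (extend A) = extend (colon R A)"
proof -
  have "\<iota> x \<in> colon D (extend A) \<longleftrightarrow> x \<in> colon R A" for x
  proof -
    have "\<iota> x \<in> colon D (extend A) \<longleftrightarrow> extend A \<subseteq> {y. \<iota> x * y \<in> D}"
      by (auto simp: colon_def)
    also have "\<dots> \<longleftrightarrow> A \<subseteq> contract {y. \<iota> x * y \<in> D}"
      by (intro extend_subset_iff submod_vimage_mult submod_self ring_D)
    also have "\<dots> \<longleftrightarrow> x \<in> colon R A"
      by (auto simp: contract_def colon_def hom_mem_ring_iff simp flip: hom_mult)
    finally show ?thesis .
  qed
  then have "contract (colon D (extend A)) = colon R A"
    by (simp add: contract_def)
  then show ?thesis
    using extend_contract[OF submod_colon[OF ring_D]] by metis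
qed

lemma trace_ideal_extend: "trace_ideal D (extend A) = extend (trace_ideal R A)"
  by (simp add: trace_ideal_def colon_extend mod_prod_extend)

definition elem_content :: "'l \<Rightarrow> 'k set" where
  "elem_content z = contract (mod_prod D {z})"

lemma mem_elem_contentE:
  assumes "x \<in> elem_content z"
  obtains d where "d \<in> D" "\<iota> x = d * z"
  using assms by (auto simp: elem_content_def contract_def generated_singleton[OF ring_D])

lemma mem_iff_elem_content_subset:
  assumes "submod D N"
  shows "z \<in> N \<longleftrightarrow> elem_content z \<subseteq> contract N"
  using generated_subset_iff[OF ring_D assms, of "{z}"] contract_subset_iff[OF submod_generated[OF ring_D] assms]
  by (simp add: elem_content_def)

lemma elem_content_mult:
  assumes "s \<in> elem_content x" "t \<in> elem_content y"
  shows "s * t \<in> elem_content (x * y)"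
proof -
  obtain d e where "d \<in> D" "\<iota> s = d * x" "e \<in> D" "\<iota> t = e * y"
    using assms mem_elem_contentE by metis
  then have "\<iota> (s * t) = (d * e) * (x * y)" "d * e \<in> D"
    using subring_mult[OF ring_D] by (simp_all add: hom_mult)
  then show ?thesis
    unfolding elem_content_def mem_contract_iff generated_singleton[OF ring_D] by blast
qed

lemma elem_content_power: "s \<in> elem_content x \<Longrightarrow> s ^ n \<in> elem_content (x ^ n)"
proof (induction n)
  case 0
  show ?case
    using generated_superset[OF ring_D, of "{1}"] by (simp add: elem_content_def mem_contract_iff hom_one)
qed (simp add: elem_content_mult)

lemma elem_content_subset_ring: "z \<in> D \<Longrightarrow> elem_content z \<subseteq> R"
  using mem_iff_elem_content_subset[OF submod_self[OF ring_D]] contract_ring by simp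

lemma is_radical_contract_iff:
  assumes N: "dom_ideal D N"
  shows "is_radical R (contract N) \<longleftrightarrow> is_radical D N"
  unfolding is_radical_iff[OF dom_ideal_subset[OF N]]
    is_radical_iff[OF dom_ideal_subset[OF dom_ideal_contract[OF N]]]
proof (intro iffI ballI allI impI)
  fix x and n :: nat
  assume rad: "\<forall>x\<in>D. \<forall>n. x ^ n \<in> N \<longrightarrow> x \<in> N" and x: "x \<in> R" "x ^ n \<in> contract N"
  then have "\<iota> x \<in> D" "\<iota> x ^ n \<in> N"
    by (simp_all add: hom_mem_ring_iff contract_def hom_power)
  then show "x \<in> contract N"
    using rad by (auto simp: contract_def)
next
  fix x and n :: nat
  assume rad: "\<forall>x\<in>R. \<forall>n. x ^ n \<in> contract N \<longrightarrow> x \<in> contract N" and x: "x \<in> D" "x ^ n \<in> N"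
  note N_submod = dom_ideal_submod[OF N]
  have "s \<in> contract N" if s: "s \<in> elem_content x" for s
  proof -
    have "s ^ n \<in> contract N"
      using elem_content_power[OF s, of n] x(2) mem_iff_elem_content_subset[OF N_submod] by blast
    then show ?thesis
      using rad elem_content_subset_ring[OF x(1)] s by blast
  qed
  then show "x \<in> N"
    using mem_iff_elem_content_subset[OF N_submod] by blast
qed

theorem tRTP_iff_RTP: "tRTP_domain R \<longleftrightarrow> RTP_domain D"
proof -
  let ?t = "\<lambda>I. t_op R (trace_ideal R I) = R \<or> is_radical R (t_op R (trace_ideal R I))"
  let ?d = "\<lambda>N. trace_ideal D N = D \<or> is_radical D (trace_ideal D N)"
  have trace: "?t I \<longleftrightarrow> ?d (extend I)" if I: "dom_ideal R I" "I \<noteq> {0}" for I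
  proof -
    have "trace_ideal R I \<noteq> {0}"
      using I ideal_subset_trace_ideal[OF I(1)] submod_zero[OF dom_ideal_submod[OF I(1)]] by blast
    then have "contract (extend (trace_ideal R I)) = t_op R (trace_ideal R I)"
      by (intro contract_extend submod_trace_ideal dom_ideal_submod I)
    moreover have "dom_ideal D (extend (trace_ideal R I))"
      by (intro dom_ideal_extend trace_ideal_subset ring_R)
    ultimately show ?thesis
      unfolding trace_ideal_extend
      using is_radical_contract_iff contract_eq_ring_iff[OF submod_extend] by metis
  qed
  have "tRTP_domain R \<longleftrightarrow> (\<forall>I. dom_ideal R I \<and> I \<noteq> {0} \<longrightarrow> ?t I)"
    by (simp add: tRTP_domain_def trace_ideal_def)
  also have "\<dots> \<longleftrightarrow> (\<forall>N. dom_ideal D N \<and> N \<noteq> {0} \<longrightarrow> ?d N)"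
  proof (intro iffI allI impI)
    fix N assume t: "\<forall>I. dom_ideal R I \<and> I \<noteq> {0} \<longrightarrow> ?t I" and N: "dom_ideal D N \<and> N \<noteq> {0}"
    then have "dom_ideal R (contract N)" "contract N \<noteq> {0}" "extend (contract N) = N"
      by (simp_all add: dom_ideal_contract dom_ideal_submod contract_eq_zero_iff extend_contract)
    then show "?d N"
      using t trace[of "contract N"] by simp
  next
    fix I assume d: "\<forall>N. dom_ideal D N \<and> N \<noteq> {0} \<longrightarrow> ?d N" and I: "dom_ideal R I \<and> I \<noteq> {0}"
    then have "dom_ideal D (extend I)" "extend I \<noteq> {0}"
      by (simp_all add: dom_ideal_extend dom_ideal_subset extend_nonzero dom_ideal_submod)
    then show "?t I"
      using d trace[of I] I by blast
  qed
  also have "\<dots> \<longleftrightarrow> RTP_domain D"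
    by (simp add: RTP_domain_def trace_ideal_def)
  finally show ?thesis .
qed

subsection \<open>Primes and localizations\<close>

lemma dom_prime_contract_iff:
  assumes N: "dom_ideal D N"
  shows "dom_prime R (contract N) \<longleftrightarrow> dom_prime D N"
proof
  note N_submod = dom_ideal_submod[OF N]
  show "dom_prime R (contract N)" if "dom_prime D N"
  proof (rule dom_primeI)
    show "dom_ideal R (contract N)"
      by (rule dom_ideal_contract[OF N])
    show "1 \<in> R" "1 \<notin> contract N"
      using subring_one[OF ring_R] dom_prime_one_notin[OF that] by (simp_all add: contract_def hom_one)
    show "a \<in> contract N \<or> b \<in> contract N" if "a \<in> R" "b \<in> R" "a * b \<in> contract N" for a b
      using dom_prime_multD[OF \<open>dom_prime D N\<close>, of "\<iota> a" "\<iota> b"] that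
      by (simp add: contract_def hom_mult hom_mem_ring_iff)
  qed
  show "dom_prime D N" if prime: "dom_prime R (contract N)"
  proof (rule dom_primeI[OF N subring_one[OF ring_D]])
    show "1 \<notin> N"
      using dom_prime_one_notin[OF prime] by (simp add: contract_def hom_one)
    fix x y assume xy: "x \<in> D" "y \<in> D" "x * y \<in> N"
    have "s \<in> contract N \<or> t \<in> contract N" if st: "s \<in> elem_content x" "t \<in> elem_content y" for s t
    proof -
      have "s * t \<in> contract N"
        using elem_content_mult[OF st] xy(3) mem_iff_elem_content_subset[OF N_submod] by blast
      then show ?thesis
        using dom_prime_multD[OF prime] elem_content_subset_ring xy(1,2) st by blast
    qed
    then have "elem_content x \<subseteq> contract N \<or> elem_content y \<subseteq> contract N"
      by blast
    then show "x \<in> N \<or> y \<in> N"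
      by (simp add: mem_iff_elem_content_subset[OF N_submod])
  qed
qed

lemma contract_image_Spec: "contract ` (Spec D - {{0}}) = {P. t_prime R P}"
proof
  show "contract ` (Spec D - {{0}}) \<subseteq> {P. t_prime R P}"
    using dom_prime_contract_iff t_ideal_contract dom_prime_ideal by (auto simp: t_prime_def)
  show "{P. t_prime R P} \<subseteq> contract ` (Spec D - {{0}})"
  proof
    fix P assume "P \<in> {P. t_prime R P}"
    then have P: "dom_prime R P" "t_ideal R P"
      by (simp_all add: t_prime_def)
    have "contract (extend P) = P"
      by (rule contract_extend_t_ideal[OF P(2)])
    moreover from this have "extend P \<in> Spec D - {{0}}"
      using P(1) dom_prime_contract_iff[of "extend P"] t_ideal_extend[OF P(2)] by simp
    ultimately show "P \<in> contract ` (Spec D - {{0}})"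
      by (metis imageI)
  qed
qed

lemma t_Max_contract_iff:
  assumes N: "dom_ideal D N" "N \<noteq> {0}"
  shows "contract N \<in> t_Max R \<longleftrightarrow> dom_maximal D N"
proof
  note N_submod = dom_ideal_submod[OF N(1)]
  assume max: "dom_maximal D N"
  have "J = contract N" if J: "t_ideal R J" "contract N \<subseteq> J" "J \<noteq> R" for J
  proof -
    note contract_extend_J = contract_extend_t_ideal[OF J(1)]
    have "N \<subseteq> extend J" "extend J \<noteq> D"
      using J(2,3) contract_subset_iff[OF N_submod submod_extend, of J]
        contract_eq_ring_iff[OF submod_extend, of J] by (simp_all add: contract_extend_J)
    then have "extend J = N"
      using max t_ideal_extend(1)[OF J(1)] by (simp add: dom_maximal_def)
    then show ?thesis
      using contract_extend_J by simp
  qed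
  moreover have "contract N \<noteq> R"
    using max contract_eq_ring_iff[OF N_submod] by (simp add: dom_maximal_def)
  ultimately show "contract N \<in> t_Max R"
    using t_ideal_contract[OF N] by (simp add: t_Max_def)
next
  note N_submod = dom_ideal_submod[OF N(1)]
  assume max: "contract N \<in> t_Max R"
  have "J = N" if J: "dom_ideal D J" "N \<subseteq> J" "J \<noteq> D" for J
  proof -
    note J_submod = dom_ideal_submod[OF J(1)]
    have "J \<noteq> {0}"
      using N(2) J(2) submod_zero[OF N_submod] by blast
    then have "contract J = contract N"
      using max J t_ideal_contract contract_mono[OF J(2)] contract_eq_ring_iff[OF J_submod]
      by (simp add: t_Max_def)
    then show ?thesis
      by (simp add: contract_eq_iff J_submod N_submod)
  qed
  moreover have "N \<noteq> D"
    using max contract_ring by (auto simp: t_Max_def)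
  ultimately show "dom_maximal D N"
    using N(1) by (simp add: dom_maximal_def)
qed

lemma dom_maximal_nonzero:
  assumes "is_domain_of R" "R \<noteq> UNIV" "dom_maximal D N"
  shows "N \<noteq> {0}"
proof
  assume "N = {0}"
  have "x \<in> R" for x
  proof -
    obtain a b where ab: "a \<in> R" "b \<in> R" "b \<noteq> 0" "x = a / b"
      using assms(1) unfolding is_domain_of_def by blast
    then have "inverse (\<iota> b) \<in> D"
      using maximal_zero_imp_inverse_closed[OF ring_D] assms(3) \<open>N = {0}\<close>
      by (simp add: hom_mem_ring_iff hom_eq_zero_iff)
    then have "\<iota> a * inverse (\<iota> b) \<in> D"
      using ab(1) by (intro subring_mult[OF ring_D]) (simp_all add: hom_mem_ring_iff)
    also have "\<iota> a * inverse (\<iota> b) = \<iota> x"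
      using ab(4) hom_divide[OF ab(3)] by (metis divide_inverse)
    finally show ?thesis
      by (simp add: hom_mem_ring_iff)
  qed
  then show False
    using assms(2) by blast
qed

lemma Max_Spec_subset_nonzero_Spec:
  assumes "is_domain_of R" "R \<noteq> UNIV"
  shows "Max_Spec D \<subseteq> Spec D - {{0}}"
  using Max_Spec_subset_Spec[OF ring_D] dom_maximal_nonzero[OF assms] by blast

lemma contract_image_Max_Spec:
  assumes "is_domain_of R" "R \<noteq> UNIV"
  shows "contract ` Max_Spec D = t_Max R"
proof
  show "contract ` Max_Spec D \<subseteq> t_Max R"
    using t_Max_contract_iff dom_maximal_nonzero[OF assms] by (auto simp: dom_maximal_def)
  show "t_Max R \<subseteq> contract ` Max_Spec D"
  proof
    fix M assume "M \<in> t_Max R"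
    moreover from this have "t_ideal R M"
      by (rule t_Max_t_ideal)
    ultimately have "dom_maximal D (extend M)" "contract (extend M) = M"
      using t_Max_contract_iff[OF t_ideal_extend] contract_extend_t_ideal by auto
    then show "M \<in> contract ` Max_Spec D"
      by (metis imageI mem_Collect_eq)
  qed
qed

lemma contract_loc:
  assumes N: "dom_prime D N"
  shows "contract (loc D N) = loc R (contract N)"
proof
  have contract_N: "dom_prime R (contract N)"
    using dom_prime_contract_iff[OF dom_prime_ideal[OF N]] N by blast
  show "loc R (contract N) \<subseteq> contract (loc D N)"
  proof
    fix x assume "x \<in> loc R (contract N)"
    then obtain a s where as: "a \<in> R" "s \<in> R" "s \<notin> contract N" "x = a / s"
      by (rule locE)
    then have "\<iota> x = \<iota> a / \<iota> s"
      using denominator_nonzero[OF ring_R contract_N] by (simp add: hom_divide)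
    then show "x \<in> contract (loc D N)"
      using as by (simp add: contract_def locI hom_mem_ring_iff)
  qed
  show "contract (loc D N) \<subseteq> loc R (contract N)"
  proof
    fix x assume "x \<in> contract (loc D N)"
    then obtain a s where as: "a \<in> D" "s \<in> D" "s \<notin> N" "\<iota> x = a / s"
      by (auto simp: contract_def elim: locE)
    obtain t where t: "t \<in> elem_content s" "t \<notin> contract N"
      using mem_iff_elem_content_subset[OF dom_prime_submod[OF N]] as(3) by blast
    obtain d where d: "d \<in> D" "\<iota> t = d * s"
      using t(1) by (rule mem_elem_contentE)
    have "\<iota> (x * t) = d * a"
      using as(3,4) denominator_nonzero[OF ring_D N] by (simp add: hom_mult d(2))
    then have "x * t \<in> R"
      using subring_mult[OF ring_D d(1) as(1)] by (simp flip: hom_mem_ring_iff)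
    moreover have "t \<in> R" "t \<noteq> 0"
      using t elem_content_subset_ring[OF as(2)] denominator_nonzero[OF ring_R contract_N] by blast+
    ultimately show "x \<in> loc R (contract N)"
      using locI[of "x * t" R t "contract N"] t(2) by simp
  qed
qed

lemma Inter_loc_contract:
  assumes "\<P> \<subseteq> Spec D"
  shows "Inter_loc R (contract ` \<P>) = contract (Inter_loc D \<P>)"
proof -
  have "loc R (contract P) = contract (loc D P)" if "P \<in> \<P>" for P
    using assms that contract_loc by blast
  then show ?thesis
    by (auto simp: Inter_loc_def mem_contract_iff)
qed

lemma inj_on_Inter_loc_contract_iff:
  assumes \<F>: "\<And>\<P>. \<P> \<in> \<F> \<Longrightarrow> \<P> \<subseteq> Spec D"
  shows "inj_on (Inter_loc R) ((`) contract ` \<F>) \<longleftrightarrow> inj_on (Inter_loc D) \<F>"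
proof -
  have "inj_on contract {N. submod D N}"
    by (rule inj_onI) (simp add: contract_eq_iff)
  then have contract_inj: "inj_on contract A" if "\<And>N. N \<in> A \<Longrightarrow> submod D N" for A
    using that by (auto intro: inj_on_subset)
  have "inj_on ((`) contract) \<F>"
    using \<F> dom_prime_submod by (intro inj_on_image contract_inj) blast
  then have "inj_on (Inter_loc R) ((`) contract ` \<F>) \<longleftrightarrow> inj_on (Inter_loc R \<circ> (`) contract) \<F>"
    by (rule comp_inj_on_iff)
  also have "\<dots> \<longleftrightarrow> inj_on (contract \<circ> Inter_loc D) \<F>"
    using Inter_loc_contract[OF \<F>] by (intro inj_on_cong) simp
  also have "\<dots> \<longleftrightarrow> inj_on (Inter_loc D) \<F>"
  proof -
    have "submod D (Inter_loc D \<P>)" if "\<P> \<in> \<F>" for \<P>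
      using overring_Inter_loc[OF ring_D \<F>[OF that]] submod_restrict_scalars[OF submod_self]
      unfolding overring_def by blast
    then have "inj_on contract (Inter_loc D ` \<F>)"
      by (intro contract_inj) blast
    then show ?thesis
      by (auto intro: comp_inj_on inj_on_imageI2)
  qed
  finally show ?thesis .
qed

theorem t_sharp_iff_sharp:
  assumes "is_domain_of R" "R \<noteq> UNIV"
  shows "t_sharp R \<longleftrightarrow> sharp_domain D"
proof -
  note Max_Spec = Max_Spec_subset_nonzero_Spec[OF assms]
  have "t_sharp R \<longleftrightarrow> inj_on (Inter_loc R) ((`) contract ` Pow (Max_Spec D))"
    by (simp add: t_sharp_iff_inj_on image_Pow_surj[OF contract_image_Max_Spec[OF assms]])
  also have "\<dots> \<longleftrightarrow> inj_on (Inter_loc D) (Pow (Max_Spec D))"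
    using Max_Spec by (intro inj_on_Inter_loc_contract_iff) auto
  also have "\<dots> \<longleftrightarrow> sharp_domain D"
    using Max_Spec inj_on_Inter_loc_minus_empty[OF ring_D, of "Pow (Max_Spec D)"]
    by (auto simp: sharp_domain_iff_inj_on)
  finally show ?thesis .
qed

lemma bezout_D: "bezout D"
  unfolding bezout_def
proof (intro conjI allI)
  fix x y
  obtain S where S: "finite S" "mod_prod D {x} = mod_prod D (\<iota> ` S)"
    using principal_has_content by blast
  obtain S' where S': "finite S'" "mod_prod D {y} = mod_prod D (\<iota> ` S')"
    using principal_has_content by blast
  obtain z where z: "mod_prod D (\<iota> ` (S \<union> S')) = mod_prod D {z}"
    using finitely_generated_principal[of "S \<union> S'"] S(1) S'(1) by blast
  note superset = generated_superset[OF ring_D] and mono = mod_prod_mono[OF order_refl[of D]]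
  have "mod_prod D {x, y} = mod_prod D (\<iota> ` (S \<union> S'))"
  proof (rule generated_eqI[OF ring_D])
    show "{x, y} \<subseteq> mod_prod D (\<iota> ` (S \<union> S'))"
      using superset[of "{x}"] superset[of "{y}"] S(2) S'(2)
        mono[of "\<iota> ` S" "\<iota> ` (S \<union> S')"] mono[of "\<iota> ` S'" "\<iota> ` (S \<union> S')"] by blast
    show "\<iota> ` (S \<union> S') \<subseteq> mod_prod D {x, y}"
      using superset[of "\<iota> ` S"] superset[of "\<iota> ` S'"] S(2) S'(2)
        mono[of "{x}" "{x, y}"] mono[of "{y}" "{x, y}"] by blast
  qed
  then show "\<exists>z. mod_prod D {x, y} = mod_prod D {z}"
    using z by metis
qed (rule ring_D)

theorem t_sharp_sharp_iff_sharp_sharp: "t_sharp_sharp R \<longleftrightarrow> sharp_sharp_domain D"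
proof -
  have "(`) contract ` antichains (Spec D - {{0}}) = antichains {P. t_prime R P}"
    unfolding contract_image_Spec[symmetric]
    by (intro image_antichains contract_subset_iff) (simp_all add: dom_prime_submod)
  then have "t_sharp_sharp R \<longleftrightarrow> inj_on (Inter_loc R) ((`) contract ` antichains (Spec D - {{0}}))"
    by (simp add: t_sharp_sharp_iff_inj_on)
  also have "\<dots> \<longleftrightarrow> inj_on (Inter_loc D) (antichains (Spec D - {{0}}))"
    by (intro inj_on_Inter_loc_contract_iff) (auto simp: antichains_def)
  also have "\<dots> \<longleftrightarrow> sharp_sharp_domain D"
    by (rule bezout_sharp_sharp_iff_inj_on[OF bezout_D, symmetric])
  finally show ?thesis .
qed

end

section \<open>Gauss' lemma over valuation domains\<close>

lemma finite_range_coeff: "finite (range (coeff p))"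
  by (simp add: range_coeff)

lemma range_coeff_subset_zero_iff: "range (coeff p) \<subseteq> {0} \<longleftrightarrow> p = 0"
  by (auto simp: poly_eq_iff)

lemma poly_with_coeffs:
  assumes "finite S"
  obtains p :: "'a::zero poly" where "range (coeff p) = insert 0 S"
proof -
  obtain xs where "set xs = S"
    using finite_list[OF assms] by blast
  then have "range (coeff (Poly xs)) = insert 0 S"
    by (simp add: coeff_Poly_eq)
  then show ?thesis
    by (rule that)
qed

lemma poly_ring_coeff: "f \<in> poly_ring R \<Longrightarrow> coeff f i \<in> R"
  by (simp add: poly_ring_def)

lemma coeff_mult_mem:
  assumes "submod D A" "\<And>i j. coeff f i * coeff h j \<in> A"
  shows "coeff (f * h) n \<in> A"
  unfolding coeff_mult by (intro submod_sum[OF assms(1)] assms(2))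

context
  fixes D :: "'a::field set"
  assumes D: "is_subring D"
begin

lemma poly_ring_zero: "0 \<in> poly_ring D"
  by (simp add: poly_ring_def subring_zero[OF D])

lemma poly_ring_one: "1 \<in> poly_ring D"
  by (simp add: poly_ring_def coeff_1 subring_zero[OF D] subring_one[OF D])

lemma poly_ring_add: "f \<in> poly_ring D \<Longrightarrow> g \<in> poly_ring D \<Longrightarrow> f + g \<in> poly_ring D"
  by (simp add: poly_ring_def subring_add[OF D])

lemma poly_ring_diff: "f \<in> poly_ring D \<Longrightarrow> g \<in> poly_ring D \<Longrightarrow> f - g \<in> poly_ring D"
  by (simp add: poly_ring_def subring_diff[OF D])

lemma poly_ring_mult: "f \<in> poly_ring D \<Longrightarrow> g \<in> poly_ring D \<Longrightarrow> f * g \<in> poly_ring D"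
  by (simp add: poly_ring_def coeff_mult_mem[OF submod_self[OF D]] subring_mult[OF D])

lemma submod_content_ideal: "submod D (content_ideal D f)"
  unfolding content_ideal_def by (rule submod_generated[OF D])

lemma coeff_mem_content_ideal: "coeff f i \<in> content_ideal D f"
  unfolding content_ideal_def using generated_superset[OF D] by blast

lemma content_ideal_subset_iff: "submod D A \<Longrightarrow> content_ideal D f \<subseteq> A \<longleftrightarrow> (\<forall>i. coeff f i \<in> A)"
  unfolding content_ideal_def by (auto simp: generated_subset_iff[OF D])

lemma dom_ideal_content_ideal: "f \<in> poly_ring D \<Longrightarrow> dom_ideal D (content_ideal D f)"
  unfolding content_ideal_def by (intro dom_ideal_generated[OF D]) (auto simp: poly_ring_coeff)

lemma content_ideal_eq_zero_iff: "content_ideal D f = {0} \<longleftrightarrow> f = 0"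
  by (simp add: content_ideal_def generated_eq_zero_iff[OF D] range_coeff_subset_zero_iff)

lemma poly_ring_mult_coeff_notin_prime:
  assumes P: "dom_prime D P" and fh: "f \<in> poly_ring D" "h \<in> poly_ring D"
    and notin: "\<exists>i. coeff f i \<notin> P" "\<exists>j. coeff h j \<notin> P"
  shows "\<exists>n. coeff (f * h) n \<notin> P"
proof
  define i where "i = (LEAST i. coeff f i \<notin> P)"
  define k where "k = (LEAST k. coeff h k \<notin> P)"
  have i: "coeff f i \<notin> P" "\<And>j. j < i \<Longrightarrow> coeff f j \<in> P"
    using LeastI_ex[OF notin(1)] not_less_Least unfolding i_def by blast+
  have k: "coeff h k \<notin> P" "\<And>j. j < k \<Longrightarrow> coeff h j \<in> P"
    using LeastI_ex[OF notin(2)] not_less_Least unfolding k_def by blast+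
  note submod = dom_prime_submod[OF P]
  let ?rest = "\<Sum>j\<in>{..i + k} - {i}. coeff f j * coeff h (i + k - j)"
  have coeff: "coeff (f * h) (i + k) = coeff f i * coeff h k + ?rest"
    unfolding coeff_mult by (subst sum.remove[of _ i]) simp_all
  have rest: "?rest \<in> P"
  proof (rule submod_sum[OF submod])
    fix j assume j: "j \<in> {..i + k} - {i}"
    then consider (left) "j < i" | (right) "i + k - j < k"
      by fastforce
    then show "coeff f j * coeff h (i + k - j) \<in> P"
    proof cases
      case left
      then show ?thesis
        by (intro submod_mult_right[OF submod] poly_ring_coeff fh i)
    next
      case right
      then show ?thesis
        by (intro submod_mult[OF submod] poly_ring_coeff fh k)
    qed
  qed
  show "coeff (f * h) (i + k) \<notin> P"
  proof
    assume "coeff (f * h) (i + k) \<in> P"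
    then have "coeff f i * coeff h k \<in> P"
      using submod_diff[OF D submod _ rest, of "coeff (f * h) (i + k)"] by (simp add: coeff)
    then show False
      using dom_prime_multD[OF P] i(1) k(1) poly_ring_coeff fh by blast
  qed
qed

lemma content_ideal_mult_primitive:
  assumes "content_ideal D f = D" "content_ideal D h = D"
  shows "content_ideal D (f * h) = D"
proof (rule ccontr)
  assume "content_ideal D (f * h) \<noteq> D"
  have fh: "f \<in> poly_ring D" "h \<in> poly_ring D"
    using coeff_mem_content_ideal[of f] coeff_mem_content_ideal[of h] assms by (simp_all add: poly_ring_def)
  then obtain N where N: "dom_maximal D N" "content_ideal D (f * h) \<subseteq> N"
    using proper_ideal_in_maximal[OF D dom_ideal_content_ideal \<open>content_ideal D (f * h) \<noteq> D\<close>] poly_ring_mult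
    by metis
  then have prime: "dom_prime D N"
    by (intro dom_maximal_prime[OF D])
  then have "\<exists>i. coeff g i \<notin> N" if "content_ideal D g = D" for g
    using that content_ideal_subset_iff[OF dom_prime_submod[OF prime], of g] subring_one[OF D]
      dom_prime_one_notin[OF prime] by blast
  then show False
    using poly_ring_mult_coeff_notin_prime[OF prime fh] assms N(2) coeff_mem_content_ideal by blast
qed

end

context
  fixes V :: "'a::field set"
  assumes V: "is_subring V" and valuation: "valuation_dom V"
begin

lemma valuation_dominating_element:
  assumes S: "finite S" "\<not> S \<subseteq> {0}"
  obtains a where "a \<in> S" "a \<noteq> 0" "\<forall>s\<in>S. s / a \<in> V"
proof -
  have "\<exists>a\<in>A. \<forall>s\<in>A. s / a \<in> V" if "finite A" "A \<noteq> {}" "0 \<notin> A" for A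
    using that
  proof (induction A rule: finite_ne_induct)
    case (singleton x)
    then show ?case
      by (simp add: subring_one[OF V])
  next
    case (insert x A)
    then obtain a where a: "a \<in> A" "\<forall>s\<in>A. s / a \<in> V"
      by auto
    have "x \<noteq> 0" "a \<noteq> 0"
      using insert.prems a(1) by auto
    show ?case
    proof (cases "x / a \<in> V")
      case True
      then show ?thesis
        using a by auto
    next
      case False
      then have "a / x \<in> V"
        using valuation unfolding valuation_dom_def by (metis inverse_divide)
      then have "s / x \<in> V" if "s \<in> A" for s
        using subring_mult[OF V, of "s / a" "a / x"] a(2) that \<open>a \<noteq> 0\<close> by simp
      then show ?thesis
        using \<open>x \<noteq> 0\<close> by (simp add: subring_one[OF V])
    qed
  qed
  from this[of "S - {0}"] obtain a where a: "a \<in> S - {0}" "\<forall>s\<in>S - {0}. s / a \<in> V"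
    using S by auto
  then have "s / a \<in> V" if "s \<in> S" for s
    using that subring_zero[OF V] by (cases "s = 0") auto
  then show ?thesis
    using that[of a] a(1) by blast
qed

lemma valuation_primitive_part:
  assumes "f \<noteq> 0"
  obtains a g where "f = smult a g" "content_ideal V g = V"
proof -
  obtain a where a: "a \<in> range (coeff f)" "a \<noteq> 0" "\<forall>s\<in>range (coeff f). s / a \<in> V"
    using valuation_dominating_element[of "range (coeff f)"] finite_range_coeff range_coeff_subset_zero_iff assms
    by metis
  define g where "g = smult (inverse a) f"
  have coeff: "coeff g i = coeff f i / a" for i
    by (simp add: g_def divide_inverse mult.commute)
  have "g \<in> poly_ring V"
    using a(3) by (simp add: poly_ring_def coeff)
  moreover have "1 \<in> content_ideal V g"
  proof -
    obtain i where "a = coeff f i"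
      using a(1) by blast
    then show ?thesis
      using coeff_mem_content_ideal[OF V, of g i] a(2) by (simp add: coeff)
  qed
  ultimately have "content_ideal V g = V"
    using dom_ideal_ne_iff[OF dom_ideal_content_ideal[OF V]] subring_one[OF V] by blast
  moreover have "f = smult a g"
    using a(2) by (simp add: g_def)
  ultimately show ?thesis
    by (intro that)
qed

lemma valuation_gauss_lemma: "coeff f i * coeff h j \<in> content_ideal V (f * h)"
proof (cases "f = 0 \<or> h = 0")
  case True
  then show ?thesis
    using submod_zero[OF submod_content_ideal[OF V]] by auto
next
  case False
  then obtain a g b k where f: "f = smult a g" "content_ideal V g = V"
    and h: "h = smult b k" "content_ideal V k = V"
    using valuation_primitive_part by metis
  note submod = submod_content_ideal[OF V, of "f * h"]
  have "a * b * coeff (g * k) n \<in> content_ideal V (f * h)" for n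
    using coeff_mem_content_ideal[OF V, of "f * h" n] by (simp add: f(1) h(1) ac_simps)
  then have "content_ideal V (g * k) \<subseteq> {x. a * b * x \<in> content_ideal V (f * h)}"
    by (simp add: content_ideal_subset_iff[OF V] submod_vimage_mult[OF submod])
  then have "a * b * 1 \<in> content_ideal V (f * h)"
    using content_ideal_mult_primitive[OF V f(2) h(2)] subring_one[OF V] by blast
  moreover have "coeff g i * coeff k j \<in> V"
    using coeff_mem_content_ideal[OF V, of g i] coeff_mem_content_ideal[OF V, of k j] f(2) h(2)
    by (auto intro: subring_mult[OF V])
  ultimately have "(coeff g i * coeff k j) * (a * b) \<in> content_ideal V (f * h)"
    using submod_mult[OF submod] by simp
  then show ?thesis
    by (simp add: f(1) h(1) ac_simps)
qed

end

lemma coeff_mult_notin_valuation_prime: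
  assumes R: "is_subring R" and P: "dom_prime R P" and V: "valuation_dom (loc R P)"
    and fh: "coeff f i * coeff h j \<in> R - P"
  shows "\<exists>n. coeff (f * h) n \<notin> P"
proof (rule ccontr)
  assume "\<not> ?thesis"
  then have "content_ideal (loc R P) (f * h) \<subseteq> loc_module R P P"
    using content_ideal_subset_iff[OF is_subring_loc[OF R P] submod_loc_module[OF R P dom_prime_submod[OF P]]]
      loc_module_superset[OF R P] by blast
  then have "coeff f i * coeff h j \<in> loc_module R P P"
    using valuation_gauss_lemma[OF is_subring_loc[OF R P] V] by blast
  then show False
    using fh loc_module_prime_Int[OF R P] by blast
qed

section \<open>The t-Nagata ring\<close>

abbreviation const_fract :: "'a::field \<Rightarrow> 'a poly fract" where
  "const_fract x \<equiv> to_fract [:x:]"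

context
  fixes R :: "'k::field set"
  assumes R: "is_subring R"
begin

lemma N_t_subset_poly_ring: "N_t R \<subseteq> poly_ring R"
  by (auto simp: N_t_def)

lemma N_t_iff: "f \<in> N_t R \<longleftrightarrow> f \<in> poly_ring R \<and> f \<noteq> 0 \<and> (\<forall>M\<in>t_Max R. \<exists>i. coeff f i \<notin> M)"
proof (cases "f \<in> poly_ring R \<and> f \<noteq> 0")
  case True
  have "t_op R (content_ideal R f) = R \<longleftrightarrow> (\<forall>M\<in>t_Max R. \<not> content_ideal R f \<subseteq> M)"
    using True
    by (intro t_op_eq_ring_iff[OF R]) (simp_all add: dom_ideal_content_ideal content_ideal_eq_zero_iff R)
  also have "\<dots> \<longleftrightarrow> (\<forall>M\<in>t_Max R. \<exists>i. coeff f i \<notin> M)"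
    using content_ideal_subset_iff[OF R t_ideal_submod[OF t_Max_t_ideal]] by blast
  finally show ?thesis
    using True by (simp add: N_t_def)
next
  case False
  have "t_op R (content_ideal R 0) \<noteq> R"
    using t_op_zero[OF R] content_ideal_eq_zero_iff[OF R, of 0] subring_one[OF R] by force
  then show ?thesis
    using False by (auto simp: N_t_def)
qed

lemma N_t_nonzero: "f \<in> N_t R \<Longrightarrow> f \<noteq> 0"
  by (simp add: N_t_iff)

lemma one_in_N_t: "1 \<in> N_t R"
proof -
  have "coeff 1 0 \<notin> M" if "M \<in> t_Max R" for M
    using dom_prime_one_notin[OF t_Max_prime[OF R that]] by simp
  then show ?thesis
    unfolding N_t_iff using poly_ring_one[OF R] by (intro conjI ballI exI[of _ 0]) simp_all
qed

lemma N_t_mult: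
  assumes "f \<in> N_t R" "h \<in> N_t R"
  shows "f * h \<in> N_t R"
proof -
  have "\<exists>n. coeff (f * h) n \<notin> M" if "M \<in> t_Max R" for M
    using poly_ring_mult_coeff_notin_prime[OF R t_Max_prime[OF R that]] assms that by (simp add: N_t_iff)
  then show ?thesis
    using assms by (simp add: N_t_iff poly_ring_mult[OF R])
qed

lemma N_t_cancel:
  assumes g: "g \<in> N_t R" and w: "\<And>i. w * coeff g i \<in> R"
  shows "w \<in> R"
proof -
  have "1 \<in> t_op R (content_ideal R g)"
    using g subring_one[OF R] by (simp add: N_t_def)
  then obtain S where S: "S \<subseteq> content_ideal R g" "1 \<in> v_op R S"
    by (rule mem_t_opE[OF R submod_content_ideal[OF R]])
  have "w \<in> colon R (content_ideal R g)"
    unfolding content_ideal_def colon_generated[OF R] using w by (auto simp: colon_def)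
  then have "w \<in> colon R S"
    using colon_antimono[OF S(1)] by blast
  then show ?thesis
    using S(2) by (auto simp: mem_v_op_iff)
qed

lemma t_NagataI: "f \<in> poly_ring R \<Longrightarrow> g \<in> N_t R \<Longrightarrow> to_fract f / to_fract g \<in> t_Nagata R"
  by (auto simp: t_Nagata_def Fract_conv_to_fract)

lemma t_NagataE:
  assumes "z \<in> t_Nagata R"
  obtains f g where "f \<in> poly_ring R" "g \<in> N_t R" "g \<noteq> 0" "z = to_fract f / to_fract g"
  using assms N_t_nonzero by (auto simp: t_Nagata_def Fract_conv_to_fract)

lemma to_fract_in_t_Nagata: "f \<in> poly_ring R \<Longrightarrow> to_fract f \<in> t_Nagata R"
  using t_NagataI[OF _ one_in_N_t] by simp

lemma is_subring_t_Nagata: "is_subring (t_Nagata R)"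
  unfolding is_subring_def
proof (intro conjI ballI)
  show "0 \<in> t_Nagata R" "1 \<in> t_Nagata R"
    using to_fract_in_t_Nagata[OF poly_ring_zero[OF R]] to_fract_in_t_Nagata[OF poly_ring_one[OF R]] by simp_all
  fix x y assume "x \<in> t_Nagata R" "y \<in> t_Nagata R"
  obtain f g where x: "f \<in> poly_ring R" "g \<in> N_t R" "g \<noteq> 0" "x = to_fract f / to_fract g"
    using \<open>x \<in> t_Nagata R\<close> by (rule t_NagataE)
  obtain f' g' where y: "f' \<in> poly_ring R" "g' \<in> N_t R" "g' \<noteq> 0" "y = to_fract f' / to_fract g'"
    using \<open>y \<in> t_Nagata R\<close> by (rule t_NagataE)
  have num: "f * g' \<in> poly_ring R" "f' * g \<in> poly_ring R" "f * f' \<in> poly_ring R"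
    using x y N_t_subset_poly_ring by (auto intro: poly_ring_mult[OF R])
  note den = N_t_mult[OF x(2) y(2)]
  have "x + y = to_fract (f * g' + f' * g) / to_fract (g * g')"
    "x - y = to_fract (f * g' - f' * g) / to_fract (g * g')"
    "x * y = to_fract (f * f') / to_fract (g * g')"
    using x(3,4) y(3,4) by (simp_all add: add_frac_eq diff_frac_eq)
  then show "x + y \<in> t_Nagata R" "x - y \<in> t_Nagata R" "x * y \<in> t_Nagata R"
    using num den by (simp_all only: t_NagataI poly_ring_add[OF R] poly_ring_diff[OF R])
qed

lemma v_op_if_const_fract_in_principal:
  assumes "const_fract x \<in> mod_prod (t_Nagata R) {to_fract p}"
  shows "x \<in> v_op R (range (coeff p))"
  unfolding mem_v_op_iff
proof
  obtain d where d: "d \<in> t_Nagata R" "const_fract x = d * to_fract p"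
    using assms unfolding generated_singleton[OF is_subring_t_Nagata] by blast
  obtain f g where fg: "f \<in> poly_ring R" "g \<in> N_t R" "g \<noteq> 0" "d = to_fract f / to_fract g"
    using d(1) by (rule t_NagataE)
  have "to_fract ([:x:] * g) = to_fract (f * p)"
    using d(2) fg(3,4) by (simp only: to_fract_mult) (simp add: field_simps)
  then have xg: "smult x g = f * p"
    by (simp only: to_fract_eq_iff) simp
  fix y assume y: "y \<in> colon R (range (coeff p))"
  show "x * y \<in> R"
  proof (rule N_t_cancel[OF fg(2)])
    fix i
    have "smult y p \<in> poly_ring R"
      using y by (simp add: poly_ring_def colon_def)
    then have "coeff (f * smult y p) i \<in> R"
      by (intro poly_ring_coeff poly_ring_mult[OF R] fg(1))
    then show "x * y * coeff g i \<in> R"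
      by (simp add: ac_simps flip: xg)
  qed
qed

end

section \<open>The t-Nagata ring of a PvMD\<close>

context
  fixes R :: "'k::field set"
  assumes domain: "is_domain_of R" and PvMD: "PvMD R"
begin

lemma R_subring: "is_subring R"
  using domain by (simp add: is_domain_of_def)

lemma t_Max_valuation: "M \<in> t_Max R \<Longrightarrow> valuation_dom (loc R M)"
  using PvMD by (simp add: PvMD_def)

lemma colon_product_notin_valuation_prime:
  assumes P: "dom_prime R P" "valuation_dom (loc R P)" and S: "finite S" "\<not> S \<subseteq> {0}"
  shows "\<not> mod_prod (colon R S) S \<subseteq> P"
proof -
  obtain a where a: "a \<in> S" "a \<noteq> 0" "\<forall>s\<in>S. s / a \<in> loc R P"
    using valuation_dominating_element[OF is_subring_loc[OF R_subring P(1)] P(2) S] .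
  then have "finite ((\<lambda>s. s / a) ` S)" "(\<lambda>s. s / a) ` S \<subseteq> loc R P"
    using S(1) by auto
  then obtain t where t: "t \<in> R" "t \<notin> P" "\<forall>x\<in>(\<lambda>s. s / a) ` S. t * x \<in> R"
    by (rule finite_common_denominator[OF R_subring P(1)])
  have "t / a \<in> colon R S"
    using t(3) by (auto simp: colon_def)
  then have "t / a * a \<in> mod_prod (colon R S) S"
    using a(1) by (rule mod_prodI)
  then show ?thesis
    using a(2) t(2) by auto
qed

lemma finitely_generated_t_invertible:
  assumes S: "finite S" "\<not> S \<subseteq> {0}"
  shows "t_op R (mod_prod (colon R S) S) = R"
proof (rule t_op_eq_ring_iff[THEN iffD2, OF R_subring])
  have "mod_prod (colon R S) S \<subseteq> R"
    by (rule mod_prod_least[OF submod_self[OF R_subring]]) (auto simp: colon_def)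
  then show "dom_ideal R (mod_prod (colon R S) S)"
    by (simp add: dom_ideal_iff_submod submod_mod_prod submod_colon R_subring)
  have "valuation_dom (loc R {0})"
    by (simp add: loc_zero[OF domain] valuation_dom_def)
  then show "mod_prod (colon R S) S \<noteq> {0}"
    using colon_product_notin_valuation_prime[OF dom_prime_zero[OF R_subring] _ S] by blast
  show "\<forall>M\<in>t_Max R. \<not> mod_prod (colon R S) S \<subseteq> M"
    using colon_product_notin_valuation_prime[OF t_Max_prime[OF R_subring] t_Max_valuation S] by blast
qed

lemma finite_t_inverse:
  assumes S: "finite S" "\<not> S \<subseteq> {0}"
  obtains B where "finite B" "B \<subseteq> colon R S" "\<And>M. submod R M \<Longrightarrow> mod_prod B S \<subseteq> M \<Longrightarrow> 1 \<in> t_op R M"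
proof -
  have "1 \<in> t_op R (mod_prod (colon R S) S)"
    using finitely_generated_t_invertible[OF S] subring_one[OF R_subring] by simp
  then obtain F where F: "finite F" "F \<subseteq> mod_prod (colon R S) S" "\<not> F \<subseteq> {0}" "1 \<in> v_op R F"
    by (rule mem_t_opE[OF R_subring submod_mod_prod[OF submod_colon[OF R_subring]]])
  from F(1,2) obtain B where B: "finite B" "B \<subseteq> colon R S" "F \<subseteq> mod_prod S B"
    unfolding mod_prod_commute[of _ S] by (rule finite_subset_mod_prodE)
  have "1 \<in> t_op R M" if "submod R M" "mod_prod B S \<subseteq> M" for M
    using that F B(3) by (intro mem_t_opI[OF R_subring, of M F]) (auto simp: mod_prod_commute[of B])
  then show ?thesis
    using that B(1,2) by blast
qed

lemma content_t_inverse: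
  assumes "f \<noteq> 0"
  obtains h where "range (coeff h) \<subseteq> colon R (range (coeff f))"
    "\<And>M. submod R M \<Longrightarrow> 1 \<notin> t_op R M \<Longrightarrow> \<exists>i j. coeff f i * coeff h j \<notin> M"
proof -
  let ?S = "range (coeff f)"
  obtain B where B: "finite B" "B \<subseteq> colon R ?S" "\<And>M. submod R M \<Longrightarrow> mod_prod B ?S \<subseteq> M \<Longrightarrow> 1 \<in> t_op R M"
    using finite_t_inverse[of ?S] finite_range_coeff range_coeff_subset_zero_iff assms by metis
  obtain h :: "'k poly" where h: "range (coeff h) = insert 0 B"
    using poly_with_coeffs[OF B(1)] .
  show ?thesis
  proof (rule that)
    show "range (coeff h) \<subseteq> colon R ?S"
      using B(2) submod_zero[OF submod_colon[OF R_subring]] by (simp add: h)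
    fix M assume M: "submod R M" "1 \<notin> t_op R M"
    show "\<exists>i j. coeff f i * coeff h j \<notin> M"
    proof (rule ccontr)
      assume contra: "\<not> ?thesis"
      have "mod_prod (range (coeff h)) ?S \<subseteq> M"
        by (rule mod_prod_least[OF M(1)]) (use contra in \<open>auto simp: mult.commute\<close>)
      moreover have "mod_prod B ?S \<subseteq> mod_prod (range (coeff h)) ?S"
        by (intro mod_prod_mono order_refl) (auto simp: h)
      ultimately show False
        using B(3)[OF M(1)] M(2) by blast
    qed
  qed
qed

text \<open>The coefficients of \<open>h\<close> generate a fractional ideal that is t-inverse to \<open>c(f)\<close>.\<close>

lemma content_cofactor:
  assumes "f \<noteq> 0"
  obtains h where "range (coeff h) \<subseteq> colon R (range (coeff f))" "f * h \<in> N_t R"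
proof -
  obtain h where h: "range (coeff h) \<subseteq> colon R (range (coeff f))"
    and outside: "\<And>M. submod R M \<Longrightarrow> 1 \<notin> t_op R M \<Longrightarrow> \<exists>i j. coeff f i * coeff h j \<notin> M"
    by (rule content_t_inverse[OF assms]) blast
  have coeff_R: "coeff f i * coeff h j \<in> R" for i j
  proof -
    have "coeff h j \<in> colon R (range (coeff f))"
      using h by blast
    then show ?thesis
      by (simp add: colon_def mult.commute)
  qed
  have "h \<noteq> 0"
    using outside[OF submod_singleton_zero] t_op_zero[OF R_subring] by auto
  moreover have "\<exists>n. coeff (f * h) n \<notin> M" if M: "M \<in> t_Max R" for M
  proof -
    note prime = t_Max_prime[OF R_subring M]
    have "1 \<notin> t_op R M"
      using t_Max_t_ideal[OF M] dom_prime_one_notin[OF prime] by (simp add: t_ideal_def)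
    then obtain i j where "coeff f i * coeff h j \<in> R - M"
      using outside[OF dom_prime_submod[OF prime]] coeff_R by blast
    then show ?thesis
      by (rule coeff_mult_notin_valuation_prime[OF R_subring prime t_Max_valuation[OF M]])
  qed
  moreover have "f * h \<in> poly_ring R"
    using coeff_mult_mem[OF submod_self[OF R_subring] coeff_R] by (simp add: poly_ring_def)
  ultimately have "f * h \<in> N_t R"
    using assms by (simp add: N_t_iff[OF R_subring])
  then show ?thesis
    using that h by blast
qed

lemma const_fract_in_principal_iff:
  assumes "p \<noteq> 0"
  shows "const_fract x \<in> mod_prod (t_Nagata R) {to_fract p} \<longleftrightarrow> x \<in> v_op R (range (coeff p))"
proof
  assume x: "x \<in> v_op R (range (coeff p))"
  obtain h where h: "range (coeff h) \<subseteq> colon R (range (coeff p))" "p * h \<in> N_t R"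
    using content_cofactor[OF assms] .
  then have "smult x h \<in> poly_ring R"
    using x by (auto simp: poly_ring_def mem_v_op_iff)
  then have "to_fract (smult x h) / to_fract (p * h) * to_fract p \<in> mod_prod (t_Nagata R) {to_fract p}"
    using h(2) by (intro mod_prodI t_NagataI[OF R_subring]) simp_all
  moreover have "h \<noteq> 0"
    using N_t_nonzero[OF R_subring h(2)] by auto
  moreover have "smult x h = [:x:] * h"
    by simp
  ultimately show "const_fract x \<in> mod_prod (t_Nagata R) {to_fract p}"
    using assms by (simp only: to_fract_mult) (simp add: field_simps)
qed (rule v_op_if_const_fract_in_principal[OF R_subring])

lemma principal_eq_generated_by_coeffs:
  "mod_prod (t_Nagata R) {to_fract p} = mod_prod (t_Nagata R) (const_fract ` range (coeff p))"
proof (rule generated_eqI[OF is_subring_t_Nagata[OF R_subring]])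
  let ?N = "mod_prod (t_Nagata R) (const_fract ` range (coeff p))"
  note D = is_subring_t_Nagata[OF R_subring]
  have monom: "to_fract (monom 1 i) * const_fract (coeff p i) \<in> ?N" for i
    by (intro mod_prodI to_fract_in_t_Nagata[OF R_subring])
      (auto simp: poly_ring_def subring_zero[OF R_subring] subring_one[OF R_subring])
  have "p = (\<Sum>i\<le>degree p. monom 1 i * [:coeff p i:])"
    by (simp add: smult_monom poly_as_sum_of_monoms)
  then have "to_fract p = (\<Sum>i\<le>degree p. to_fract (monom 1 i) * const_fract (coeff p i))"
    by (metis (no_types, lifting) sum.cong to_fract_mult to_fract_sum)
  also have "\<dots> \<in> ?N"
    by (intro submod_sum[OF submod_generated[OF D]] monom)
  finally show "{to_fract p} \<subseteq> ?N"
    by simp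
  have "const_fract (coeff p i) \<in> mod_prod (t_Nagata R) {to_fract p}" for i
  proof (cases "p = 0")
    case True
    then show ?thesis
      using submod_zero[OF submod_generated[OF D]] by simp
  next
    case False
    then show ?thesis
      using v_op_extensive[of "range (coeff p)" R] by (auto simp: const_fract_in_principal_iff)
  qed
  then show "const_fract ` range (coeff p) \<subseteq> mod_prod (t_Nagata R) {to_fract p}"
    by blast
qed

lemma generated_by_constants_eq_principal:
  assumes "range (coeff p) = insert 0 S"
  shows "mod_prod (t_Nagata R) (const_fract ` S) = mod_prod (t_Nagata R) {to_fract p}"
  unfolding principal_eq_generated_by_coeffs assms
  using generated_insert_zero[OF is_subring_t_Nagata[OF R_subring], of "const_fract ` S"] by simp

lemma const_fract_in_generated_iff_v_op:
  assumes S: "finite S" "\<not> S \<subseteq> {0}"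
  shows "const_fract x \<in> mod_prod (t_Nagata R) (const_fract ` S) \<longleftrightarrow> x \<in> v_op R S"
proof -
  obtain p :: "'k poly" where p: "range (coeff p) = insert 0 S"
    using poly_with_coeffs[OF S(1)] .
  then have "p \<noteq> 0"
    using range_coeff_subset_zero_iff[of p] S(2) by auto
  then show ?thesis
    by (simp add: generated_by_constants_eq_principal[OF p] const_fract_in_principal_iff p
        v_op_insert_zero[OF R_subring])
qed

text \<open>Multiplying \<open>z = f / g\<close> by the unit \<open>g h\<close>, where \<open>h\<close> is a cofactor of \<open>g\<close>, clears the denominator.\<close>

lemma principal_generated_by_constants:
  "\<exists>S. finite S \<and> mod_prod (t_Nagata R) {z} = mod_prod (t_Nagata R) (const_fract ` S)"
proof -
  note D = is_subring_t_Nagata[OF R_subring]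
  obtain f g where fg: "z = Fract f g" "g \<noteq> 0"
    by (cases z)
  obtain h where h: "g * h \<in> N_t R"
    using content_cofactor[OF fg(2)] by metis
  then have gh: "g * h \<noteq> 0"
    by (rule N_t_nonzero[OF R_subring])
  then have z: "to_fract (f * h) = to_fract (g * h) * z"
    using fg by (simp add: Fract_conv_to_fract)
  have unit: "to_fract (g * h) \<in> t_Nagata R" "to_fract 1 / to_fract (g * h) \<in> t_Nagata R"
    using h N_t_subset_poly_ring[OF R_subring] to_fract_in_t_Nagata[OF R_subring]
      t_NagataI[OF R_subring poly_ring_one[OF R_subring]] by blast+
  have "mod_prod (t_Nagata R) {z} = mod_prod (t_Nagata R) {to_fract (f * h)}"
  proof (rule generated_eqI[OF D])
    have "z = to_fract 1 / to_fract (g * h) * to_fract (f * h)"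
      unfolding z using gh by simp
    also have "\<dots> \<in> mod_prod (t_Nagata R) {to_fract (f * h)}"
      using unit(2) by (intro mod_prodI) simp_all
    finally show "{z} \<subseteq> mod_prod (t_Nagata R) {to_fract (f * h)}"
      by simp
    show "{to_fract (f * h)} \<subseteq> mod_prod (t_Nagata R) {z}"
      unfolding z using unit(1) by (auto intro: mod_prodI)
  qed
  then show ?thesis
    unfolding principal_eq_generated_by_coeffs using finite_range_coeff by blast
qed

lemma content_extension_t_Nagata: "content_extension const_fract R (t_Nagata R)"
proof
  show "const_fract (x + y) = const_fract x + const_fract y" for x y :: 'k
    by (simp flip: to_fract_add)
  show "const_fract (x * y) = const_fract x * const_fract y" for x y :: 'k
    by (simp flip: to_fract_mult)
  show "const_fract (1 :: 'k) = 1"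
    by (simp flip: one_pCons)
  show "\<exists>z. mod_prod (t_Nagata R) (const_fract ` S) = mod_prod (t_Nagata R) {z}" if "finite S" for S
    using poly_with_coeffs[OF that] generated_by_constants_eq_principal by metis
qed (fact R_subring is_subring_t_Nagata[OF R_subring] principal_generated_by_constants
    const_fract_in_generated_iff_v_op)+

end

theorem theorem1p18:
  fixes R :: "'k::field set"
  assumes "is_domain_of R" and "R \<noteq> UNIV" and "PvMD R"
  shows "(t_sharp R \<longleftrightarrow> sharp_domain (t_Nagata R))
       \<and> (t_sharp_sharp R \<longleftrightarrow> sharp_sharp_domain (t_Nagata R))
       \<and> (tRTP_domain R \<longleftrightarrow> RTP_domain (t_Nagata R))"
proof -
  interpret content_extension const_fract R "t_Nagata R"
    by (rule content_extension_t_Nagata[OF assms(1,3)])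
  show ?thesis
    using t_sharp_iff_sharp[OF assms(1,2)] t_sharp_sharp_iff_sharp_sharp tRTP_iff_RTP by blast
qed

end
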